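(* Let $B\in\mathrm{M}_3(\mathbb{R})$ be a cluster-cyclic skew-symmetrizable matrix. Then the exchange graph $\mathbf{EG}(\mathbf C)$ of its $C$-pattern and the exchange graph $\mathbf{EG}(\mathbf G)$ of its $G$-pattern are both $3$-regular trees.
   Context: A matrix $B=(b_{ij})\in\mathrm{M}_3(\mathbb{R})$ is skew-symmetrizable if $DB$ is skew-symmetric for some positive diagonal $D$. Notation: $[a]_+=\max(a,0)$, entrywise on matrices; $J_k$ is diagonal with $k$th entry $-1$, others $1$; $A^{\bullet k}$ (resp. $A^{k\bullet}$) keeps only the $k$th column (resp. row) of $A$. Mutation: $\mu_k(B)=(J_k+[-B]_+^{\bullet k})B(J_k+[B]_+^{k\bullet})$. $\mathcal T$ is the set of reduced sequences $\mathbf w=[k_1,\dots,k_r]$ ($k_i\in\{1,2,3\}$, $k_i\ne k_{i+1}$), including $\emptyset$; $\mathbf w[k]$ appends $k$ if $\mathbf w=\emptyset$ or $k\ne k_r$ and deletes the last entry if $k=k_r$. $B^{\mathbf w}=\mu_{k_r}\cdots\mu_{k_1}(B)$. $C$- and $G$-matrices: $C^\emptyset=G^\emptyset=I$, $C^{\mathbf w[k]}=C^{\mathbf w}J_k+C^{\mathbf w}[B^{\mathbf w}]_+^{k\bullet}+[-C^{\mathbf w}]_+^{\bullet k}B^{\mathbf w}$, $G^{\mathbf w[k]}=G^{\mathbf w}J_k+G^{\mathbf w}[-B^{\mathbf w}]_+^{\bullet k}-B[-C^{\mathbf w}]_+^{\bullet k}$ (here $B=B^\emptyset$ is the initial matrix).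 Two matrices $M,M'$ define the same unlabeled matrix, $[M]=[M']$, if $M'$ is obtained from $M$ by permuting columns. $\mathcal T$ is regarded as a graph in which $\mathbf w,\mathbf u$ are adjacent iff $\mathbf u=\mathbf w[k]$ for some $k$ (a $3$-regular tree). $\mathbf{EG}(\mathbf C)$ (resp. $\mathbf{EG}(\mathbf G)$) is the quotient graph of $\mathcal T$ by $\mathbf w\sim\mathbf u\iff[C^{\mathbf w}]=[C^{\mathbf u}]$ (resp. $[G^{\mathbf w}]=[G^{\mathbf u}]$): vertices are equivalence classes, and two classes are adjacent iff they contain adjacent representatives. $B$ is cyclic if $\mathrm{sign}(B)=\pm\begin{pmatrix}0&-1&1\\1&0&-1\\-1&1&0\end{pmatrix}$ entrywise; cluster-cyclic if all $B^{\mathbf w}$ are cyclic. *)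

theory Defs
  imports "HOL-Analysis.Analysis" "Graph_Theory.Digraph_Component"
begin

section \<open>Mutation of 3 by 3 matrices\<close>

text \<open>The index set is the three-element type \<^typ>\<open>3\<close>, whose elements are 1, 2 and 3 = 0.
  In \<^term>\<open>M $ i $ j\<close>, \<open>i\<close> is the row and \<open>j\<close> the column.\<close>

type_synonym mat3 = "real^3^3"

definition skew_symmetrizable :: "mat3 \<Rightarrow> bool" where
  "skew_symmetrizable B \<longleftrightarrow>
     (\<exists>D :: mat3. (\<forall>i j. i \<noteq> j \<longrightarrow> D $ i $ j = 0) \<and> (\<forall>i. D $ i $ i > 0) \<and>
        transpose (D ** B) = - (D ** B))"

definition pos_part :: "mat3 \<Rightarrow> mat3" where
  "pos_part A = map_matrix (\<lambda>a. max a 0) A"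

definition J :: "3 \<Rightarrow> mat3" where
  "J k = (\<chi> i j. if i = j then (if i = k then -1 else 1) else 0)"

definition only_col :: "3 \<Rightarrow> mat3 \<Rightarrow> mat3" where
  "only_col k A = (\<chi> i j. if j = k then A $ i $ j else 0)"

definition only_row :: "3 \<Rightarrow> mat3 \<Rightarrow> mat3" where
  "only_row k A = (\<chi> i j. if i = k then A $ i $ j else 0)"

definition mutate :: "3 \<Rightarrow> mat3 \<Rightarrow> mat3" where
  "mutate k B = (J k + only_col k (pos_part (- B))) ** B ** (J k + only_row k (pos_part B))"


section \<open>Reduced sequences\<close>

definition reduced_seqs :: "3 list set" where
  "reduced_seqs = {w. distinct_adj w}"

text \<open>\<open>step w k\<close> is the sequence written \<open>w[k]\<close>.\<close>

definition step :: "3 list \<Rightarrow> 3 \<Rightarrow> 3 list" where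
  "step w k = (if w = [] \<or> k \<noteq> last w then w @ [k] else butlast w)"

definition seq_graph :: "3 list pair_pre_digraph" where
  "seq_graph = \<lparr> pverts = reduced_seqs,
                 parcs = {(w, u). w \<in> reduced_seqs \<and> u \<in> reduced_seqs \<and> (\<exists>k. u = step w k)} \<rparr>"


section \<open>B-, C- and G-matrices\<close>

text \<open>The recursion is run along the entries of the sequence, i.e. along those instances
  of the defining recurrences in which \<open>w[k]\<close> appends \<open>k\<close>; these determine all the matrices. 
  For skew-symmetrizable initial matrix \<open>B\<^sub>0\<close> the instances in which \<open>w[k]\<close> deletes the last entry
  are consequences: \<open>mutate k\<close> is an involution, the C-recurrence undoes itself, and the
  G-recurrence does so because of the identity \<open>G\<^sup>w B\<^sup>w = B\<^sub>0 C\<^sup>w\<close>.\<close>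

definition seed_step :: "mat3 \<Rightarrow> mat3 \<times> mat3 \<times> mat3 \<Rightarrow> 3 \<Rightarrow> mat3 \<times> mat3 \<times> mat3" where
  "seed_step B\<^sub>0 = (\<lambda>(B, C, G) k.
     (mutate k B,
      C ** J k + C ** only_row k (pos_part B) + only_col k (pos_part (- C)) ** B,
      G ** J k + G ** only_col k (pos_part (- B)) - B\<^sub>0 ** only_col k (pos_part (- C))))"

definition seed :: "mat3 \<Rightarrow> 3 list \<Rightarrow> mat3 \<times> mat3 \<times> mat3" where
  "seed B\<^sub>0 w = foldl (seed_step B\<^sub>0) (B\<^sub>0, mat 1, mat 1) w"

definition B_mat :: "mat3 \<Rightarrow> 3 list \<Rightarrow> mat3" where
  "B_mat B\<^sub>0 w = fst (seed B\<^sub>0 w)"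

definition C_mat :: "mat3 \<Rightarrow> 3 list \<Rightarrow> mat3" where
  "C_mat B\<^sub>0 w = fst (snd (seed B\<^sub>0 w))"

definition G_mat :: "mat3 \<Rightarrow> 3 list \<Rightarrow> mat3" where
  "G_mat B\<^sub>0 w = snd (snd (seed B\<^sub>0 w))"

lemma B_mat_simps:
  "B_mat B\<^sub>0 [] = B\<^sub>0"
  "B_mat B\<^sub>0 (w @ [k]) = mutate k (B_mat B\<^sub>0 w)"
  by (simp_all add: B_mat_def seed_def seed_step_def split: prod.splits)

lemma C_mat_simps:
  "C_mat B\<^sub>0 [] = mat 1"
  "C_mat B\<^sub>0 (w @ [k]) =
     C_mat B\<^sub>0 w ** J k + C_mat B\<^sub>0 w ** only_row k (pos_part (B_mat B\<^sub>0 w))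
     + only_col k (pos_part (- C_mat B\<^sub>0 w)) ** B_mat B\<^sub>0 w"
  by (simp_all add: B_mat_def C_mat_def seed_def seed_step_def split: prod.splits)

lemma G_mat_simps:
  "G_mat B\<^sub>0 [] = mat 1"
  "G_mat B\<^sub>0 (w @ [k]) =
     G_mat B\<^sub>0 w ** J k + G_mat B\<^sub>0 w ** only_col k (pos_part (- B_mat B\<^sub>0 w))
     - B\<^sub>0 ** only_col k (pos_part (- C_mat B\<^sub>0 w))"
  by (simp_all add: B_mat_def C_mat_def G_mat_def seed_def seed_step_def split: prod.splits)

definition cyclic_sign :: mat3 where
  "cyclic_sign = vector [vector [ 0, -1,  1],
                         vector [ 1,  0, -1],
                         vector [-1,  1,  0]]"

definition cyclic :: "mat3 \<Rightarrow> bool" where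
  "cyclic B \<longleftrightarrow> map_matrix sgn B = cyclic_sign \<or> map_matrix sgn B = - cyclic_sign"

definition cluster_cyclic :: "mat3 \<Rightarrow> bool" where
  "cluster_cyclic B \<longleftrightarrow> (\<forall>w \<in> reduced_seqs. cyclic (B_mat B w))"


section \<open>Exchange graphs\<close>

definition same_unlabeled :: "mat3 \<Rightarrow> mat3 \<Rightarrow> bool" where
  "same_unlabeled M M' \<longleftrightarrow> (\<exists>\<sigma> :: 3 \<Rightarrow> 3. bij \<sigma> \<and> M' = (\<chi> i j. M $ i $ \<sigma> j))"

lemma same_unlabeled_refl: "same_unlabeled M M"
  unfolding same_unlabeled_def by (rule exI[of _ id]) (simp add: vec_eq_iff)

lemma same_unlabeled_sym:
  assumes "same_unlabeled M N"
  shows "same_unlabeled N M"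
proof -
  from assms obtain \<sigma> where "bij \<sigma>" "N = (\<chi> i j. M $ i $ \<sigma> j)"
    unfolding same_unlabeled_def by blast
  then show ?thesis
    unfolding same_unlabeled_def
    by (intro exI[of _ "inv \<sigma>"]) (simp add: bij_imp_bij_inv vec_eq_iff bij_is_surj surj_f_inv_f)
qed

lemma same_unlabeled_trans:
  assumes "same_unlabeled L M" "same_unlabeled M N"
  shows "same_unlabeled L N"
proof -
  from assms obtain \<sigma> \<tau> where "bij \<sigma>" "M = (\<chi> i j. L $ i $ \<sigma> j)"
      "bij \<tau>" "N = (\<chi> i j. M $ i $ \<tau> j)"
    unfolding same_unlabeled_def by blast
  then show ?thesis
    unfolding same_unlabeled_def
    by (intro exI[of _ "\<sigma> \<circ> \<tau>"]) (simp add: bij_comp vec_eq_iff)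
qed

definition unlabeled_rel :: "(3 list \<Rightarrow> mat3) \<Rightarrow> 3 list rel" where
  "unlabeled_rel M = {(w, u). w \<in> reduced_seqs \<and> u \<in> reduced_seqs \<and> same_unlabeled (M w) (M u)}"

lemma equiv_unlabeled_rel: "equiv reduced_seqs (unlabeled_rel M)"
  by (rule equivI)
     (auto simp: unlabeled_rel_def refl_on_def sym_def trans_def
           intro: same_unlabeled_refl same_unlabeled_sym same_unlabeled_trans)

text \<open>Undirected graphs are represented as symmetric digraphs without parallel arcs.
  Adjacent equivalent vertices give a loop in the quotient.\<close>

definition quotient_graph :: "'a pair_pre_digraph \<Rightarrow> 'a rel \<Rightarrow> 'a set pair_pre_digraph" where
  "quotient_graph T r =
     \<lparr> pverts = pverts T // r,
       parcs = {(X, Y). X \<in> pverts T // r \<and> Y \<in> pverts T // r \<and>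
                        (\<exists>w \<in> X. \<exists>u \<in> Y. (w, u) \<in> parcs T)} \<rparr>"

definition EG_C :: "mat3 \<Rightarrow> 3 list set pair_pre_digraph" where
  "EG_C B = quotient_graph seq_graph (unlabeled_rel (C_mat B))"

definition EG_G :: "mat3 \<Rightarrow> 3 list set pair_pre_digraph" where
  "EG_G B = quotient_graph seq_graph (unlabeled_rel (G_mat B))"

text \<open>The library's \<^const>\<open>Digraph_Component.tree\<close> concerns directed cycles, so that in a
  symmetric digraph traversing an edge back and forth would count as a cycle. The cycles of the
  underlying undirected loopless graph are those of length at least 3.
  Loops are excluded by \<^const>\<open>pair_bidirected_digraph\<close>, which also requires that every
  arc has its reverse; non-emptiness is part of \<^const>\<open>Digraph_Component.connected\<close>.\<close>

definition undirected_tree :: "'a pair_pre_digraph \<Rightarrow> bool" where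
  "undirected_tree G \<longleftrightarrow> pair_bidirected_digraph G \<and> Digraph_Component.connected (with_proj G) \<and>
     \<not> (\<exists>p. pre_digraph.cycle (with_proj G) p \<and> length p \<ge> 3)"

definition regular :: "nat \<Rightarrow> 'a pair_pre_digraph \<Rightarrow> bool" where
  "regular d G \<longleftrightarrow> (\<forall>v \<in> pverts G. finite (out_arcs (with_proj G) v) \<and> out_degree (with_proj G) v = d)"

end

theory Submission
  imports Defs
begin

text \<open>Both exchange graphs are quotients of a \<open>3\<close>-regular tree, so it suffices that different
  reduced sequences have different unlabeled matrices. Conjugation by a positive diagonal matrix makes
  \<open>B\<close> skew-symmetric; cluster-cyclicity then forces \<open>\<bar>b\<^sub>i\<^sub>j\<bar> \<ge> 2\<close>, since alternating two
  mutations would otherwise produce a positive sequence \<open>x\<^sub>n\<^sub>+\<^sub>2 = p x\<^sub>n\<^sub>+\<^sub>1 - x\<^sub>n\<close> with \<open>p < 2\<close>. From this bound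
  the columns of the \<open>C\<close>-matrices are sign-coherent, so that \<open>C\<close> and \<open>G\<close> are products of elementary
  matrices and \<open>C\<^sup>T G = 1\<close>. Moving the initial seed along \<open>k\<close> multiplies \<open>C\<close> from the left by an
  elementary matrix whose sign is the sign of the \<open>k\<close>-th row of \<open>G\<close>; that these rows are sign-coherent is
  proved along with it, as \<open>G\<^sup>T\<close> is a \<open>C\<close>-matrix of the reversed sequence. As the row sign depends only on
  the unlabeled \<open>G\<close>-matrix, an equality for \<open>w\<close> and \<open>u\<close> can be transported to the initial seed of \<open>w\<close>, where
  it compares the identity matrix with a \<open>C\<close>-matrix having a negative column unless \<open>w = u\<close>.\<close>


section \<open>Elementary matrices\<close>

definition skew :: "mat3 \<Rightarrow> bool" where
  "skew B \<longleftrightarrow> transpose B = - B"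

text \<open>\<open>e\<close> is meant to be the sign of the column of a C-matrix at which one
  mutates: mutation then multiplies C by this matrix from the right, and G by its transpose.\<close>

definition elem_mat :: "real \<Rightarrow> 3 \<Rightarrow> mat3 \<Rightarrow> mat3" where
  "elem_mat e k B = J k + only_row k (pos_part (e *\<^sub>R B))"

lemma skewD: "skew B \<Longrightarrow> B $ x $ y = - B $ y $ x"
  unfolding skew_def by (metis (mono_tags, lifting) transpose_def vec_lambda_beta vector_uminus_component)

lemma skewI: "(\<And>x y. B $ x $ y = - B $ y $ x) \<Longrightarrow> skew B"
  unfolding skew_def vec_eq_iff by (metis (mono_tags, lifting) transpose_def vec_lambda_beta vector_uminus_component)

lemma skew_diag [simp]: "skew B \<Longrightarrow> B $ x $ x = 0"
  using skewD[of B x x] by simp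

lemma mult_elem_nth:
  "(M ** elem_mat e k B) $ r $ y = (if y = k then - M $ r $ k else M $ r $ y) + M $ r $ k * max (e * B $ k $ y) 0"
proof -
  have "M $ r $ z * elem_mat e k B $ z $ y =
      (if z = y then (if y = k then - M $ r $ k else M $ r $ y) else 0) + (if z = k then M $ r $ k * max (e * B $ k $ y) 0 else 0)" for z
    by (auto simp: elem_mat_def J_def only_row_def pos_part_def map_matrix_def algebra_simps)
  then show ?thesis
    by (simp add: matrix_matrix_mult_def sum.distrib)
qed

lemma elem_mult_nth:
  "(elem_mat e k B ** M) $ r $ y = (if r = k then - M $ k $ y + (\<Sum>z\<in>UNIV. max (e * B $ k $ z) 0 * M $ z $ y) else M $ r $ y)"
proof -
  have "elem_mat e k B $ r $ z * M $ z $ y =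
      (if z = r then (if r = k then - M $ k $ y else M $ r $ y) else 0) + (if r = k then max (e * B $ k $ z) 0 * M $ z $ y else 0)" for z
    by (auto simp: elem_mat_def J_def only_row_def pos_part_def map_matrix_def algebra_simps)
  then show ?thesis
    by (simp add: matrix_matrix_mult_def sum.distrib)
qed

lemma elem_nth:
  "elem_mat e k B $ x $ y = (if x = y then if x = k then -1 else 1 else 0) + (if x = k then max (e * B $ k $ y) 0 else 0)"
  by (auto simp: elem_mat_def J_def only_row_def pos_part_def map_matrix_def)

lemma elem_cong: "(\<And>y. e * B $ k $ y = e' * B' $ k $ y) \<Longrightarrow> elem_mat e k B = elem_mat e' k B'"
  by (simp add: vec_eq_iff elem_nth)

text \<open>The added row has entry 0 at \<open>k\<close>, as skew-symmetry gives
  \<open>B $ k $ k = 0\<close>; so the second factor subtracts what the first has added.\<close>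

lemma elem_involution:
  assumes "skew B"
  shows "elem_mat e k B ** elem_mat e k B = mat 1"
  using assms by (auto simp: vec_eq_iff mult_elem_nth elem_nth mat_def)

lemma elem_mult_cancel:
  assumes "skew B"
  shows "elem_mat e k B ** (elem_mat e k B ** M) = M" "M ** elem_mat e k B ** elem_mat e k B = M"
  using elem_involution[OF assms] by (metis matrix_mul_assoc matrix_mul_lid matrix_mul_rid)+

lemma transpose_elem_mult_nth:
  "(transpose (elem_mat e k B) ** M) $ x $ y = (if x = k then - M $ k $ y else M $ x $ y) + max (e * B $ k $ x) 0 * M $ k $ y"
proof -
  have "transpose (elem_mat e k B) ** M = transpose (transpose M ** elem_mat e k B)"
    by (simp add: matrix_transpose_mul)
  then show ?thesis
    by (simp add: transpose_def mult_elem_nth)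
qed

lemma transpose_elem_involution:
  assumes "skew B"
  shows "transpose (elem_mat e k B) ** transpose (elem_mat e k B) = mat 1"
  using elem_involution[OF assms, of e k] by (metis matrix_transpose_mul transpose_mat)

lemma transpose_elem_mult_cancel:
  assumes "skew B"
  shows "transpose (elem_mat e k B) ** (transpose (elem_mat e k B) ** M) = M" "M ** transpose (elem_mat e k B) ** transpose (elem_mat e k B) = M"
  using transpose_elem_involution[OF assms] by (metis matrix_mul_assoc matrix_mul_lid matrix_mul_rid)+

section \<open>Mutation as a congruence by an elementary matrix\<close>

lemma mutate_eq_elem_pos:
  assumes "skew B"
  shows "mutate k B = transpose (elem_mat 1 k B) ** B ** elem_mat 1 k B"
proof -
  have "J k + only_col k (pos_part (- B)) = transpose (elem_mat 1 k B)"
    using assms[unfolded skew_def, symmetric]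
    by (auto simp: vec_eq_iff transpose_def elem_nth J_def only_col_def pos_part_def map_matrix_def)
  moreover have "J k + only_row k (pos_part B) = elem_mat 1 k B"
    by (simp add: elem_mat_def)
  ultimately show ?thesis
    by (simp add: mutate_def)
qed

lemma max_zero_conv_uminus: "max (t::real) 0 = t + max (- t) 0"
  by auto

text \<open>The matrices for the two signs differ only in row \<open>k\<close>, by row
  \<open>k\<close> of \<open>B\<close>, and skew-symmetry makes the resulting changes on the two
  sides of \<open>B\<close> cancel. So the congruence may use the sign of a column of C.\<close>

lemma mutate_eq_elem:
  assumes "skew B" "e \<in> {1, -1}"
  shows "mutate k B = transpose (elem_mat e k B) ** B ** elem_mat e k B"
proof -
  have "(transpose (elem_mat 1 k B) ** B ** elem_mat 1 k B) $ x $ y = (transpose (elem_mat (-1) k B) ** B ** elem_mat (-1) k B) $ x $ y" for x y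
  proof -
    \<comment> \<open>After \<open>max t 0 = t + max (- t) 0\<close>, both sides are polynomials in
      the same quantities.\<close>
    define t u where "t = max (- B $ k $ x) 0" and "u = max (- B $ k $ y) 0"
    have *: "max (B $ k $ x) 0 = B $ k $ x + t" "max (B $ k $ y) 0 = B $ k $ y + u" "B $ x $ k = - B $ k $ x"
      unfolding t_def u_def using skewD[OF assms(1), of x k] by auto
    show ?thesis
      apply (simp only: transpose_elem_mult_nth mult_elem_nth mult_1 mult_minus1 t_def[symmetric] u_def[symmetric] *(1,2) skew_diag[OF assms(1)])
      apply (cases "x = k"; cases "y = k")
      using * assms(1) by (simp_all add: algebra_simps t_def u_def)
  qed
  then show ?thesis
    using assms(2) mutate_eq_elem_pos[OF assms(1)] by (auto simp: vec_eq_iff)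
qed

lemma mutate_nth:
  assumes "skew B"
  shows "mutate k B $ x $ y = (if x = k \<or> y = k then - B $ x $ y else
           B $ x $ y + B $ x $ k * max (B $ k $ y) 0 + max (- B $ x $ k) 0 * B $ k $ y)"
proof -
  have "B $ x $ k = - B $ k $ x"
    using skewD[OF assms] .
  then show ?thesis
    using assms by (cases "x = k") (simp_all add: mutate_eq_elem_pos transpose_elem_mult_nth mult_elem_nth)
qed

lemma skew_mutate:
  assumes "skew B"
  shows "skew (mutate k B)"
proof -
  have "transpose (mutate k B) = transpose (elem_mat 1 k B) ** transpose B ** elem_mat 1 k B"
    by (simp add: mutate_eq_elem_pos[OF assms] matrix_transpose_mul matrix_mul_assoc)
  also have "\<dots> = - mutate k B"
    using assms unfolding mutate_eq_elem_pos[OF assms] skew_def[of B]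
    by (simp add: vec_eq_iff mult_elem_nth transpose_elem_mult_nth algebra_simps)
  finally show ?thesis
    by (simp add: skew_def)
qed

text \<open>Only \<open>e\<close> times row \<open>k\<close> enters, and mutation at
  \<open>k\<close> negates this row.\<close>

lemma elem_mutate:
  assumes "skew B"
  shows "elem_mat e k (mutate k B) = elem_mat (- e) k B"
  using assms by (intro elem_cong) (simp add: mutate_nth)

lemma elem_uminus: "elem_mat e k (- B) = elem_mat (- e) k B"
  by (intro elem_cong) simp

text \<open>With sign -1 the second congruence uses the matrix of the first one, an
  involution.\<close>

lemma mutate_involution:
  assumes "skew B"
  shows "mutate k (mutate k B) = B"
proof -
  have "mutate k (mutate k B) = transpose (elem_mat 1 k B) ** mutate k B ** elem_mat 1 k B"
    by (subst mutate_eq_elem[OF skew_mutate[OF assms], of "-1"]) (simp_all add: elem_mutate[OF assms])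
  then show ?thesis
    by (simp add: mutate_eq_elem_pos[OF assms] matrix_mul_assoc transpose_elem_involution[OF assms] elem_mult_cancel[OF assms])
qed

lemma skew_uminus:
  assumes "skew B"
  shows "skew (- B)"
proof (rule skewI)
  fix x y
  show "(- B) $ x $ y = - (- B) $ y $ x"
    using skewD[OF assms, of x y] by simp
qed

lemma mutate_uminus:
  assumes "skew B"
  shows "mutate k (- B) = - mutate k B"
proof -
  have "mutate k (- B) = transpose (elem_mat 1 k B) ** (- B) ** elem_mat 1 k B"
    by (subst mutate_eq_elem[OF skew_uminus[OF assms], of "-1"]) (simp_all add: elem_uminus)
  also have "\<dots> = - mutate k B"
    unfolding mutate_eq_elem_pos[OF assms]
    by (simp add: vec_eq_iff mult_elem_nth transpose_elem_mult_nth algebra_simps)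
  finally show ?thesis .
qed

section \<open>Cluster-cyclic skew-symmetric matrices\<close>

lemma B_mat_eq_foldl: "B_mat B w = foldl (\<lambda>M k. mutate k M) B w"
  by (induction w rule: rev_induct) (simp_all add: B_mat_simps)

lemma B_mat_Cons: "B_mat B (k # w) = B_mat (mutate k B) w"
  by (simp add: B_mat_eq_foldl)

lemma skew_B_mat: "skew B \<Longrightarrow> skew (B_mat B w)"
  by (induction w rule: rev_induct) (simp_all add: B_mat_simps skew_mutate)

lemma B_mat_uminus: "skew B \<Longrightarrow> B_mat (- B) w = - B_mat B w"
  by (induction w rule: rev_induct) (simp_all add: B_mat_simps mutate_uminus skew_B_mat)

lemma B_mat_rev: "skew B \<Longrightarrow> B_mat (B_mat B w) (rev w) = B"
  by (induction w rule: rev_induct) (simp_all add: B_mat_simps B_mat_Cons mutate_involution skew_B_mat)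

lemma reduced_Nil: "[] \<in> reduced_seqs"
  by (simp add: reduced_seqs_def)

lemma reduced_Cons: "k # w \<in> reduced_seqs \<longleftrightarrow> w \<in> reduced_seqs \<and> (w = [] \<or> k \<noteq> hd w)"
  by (auto simp: reduced_seqs_def distinct_adj_Cons)

lemma reduced_snoc: "w @ [k] \<in> reduced_seqs \<longleftrightarrow> w \<in> reduced_seqs \<and> (w = [] \<or> k \<noteq> last w)"
  by (auto simp: reduced_seqs_def distinct_adj_append_iff)

lemma reduced_rev: "rev w \<in> reduced_seqs \<longleftrightarrow> w \<in> reduced_seqs"
  by (simp add: reduced_seqs_def)

definition skew_cluster_cyclic :: "mat3 \<Rightarrow> bool" where
  "skew_cluster_cyclic B \<longleftrightarrow> skew B \<and> cluster_cyclic B"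

lemma skew_cluster_cyclic_skew [simp]: "skew_cluster_cyclic B \<Longrightarrow> skew B"
  by (simp add: skew_cluster_cyclic_def)

text \<open>Sequences from the mutated matrix become sequences from \<open>B\<close> by deleting a
  leading \<open>k\<close> or else prefixing one; both keep them reduced.\<close>

lemma skew_cluster_cyclic_mutate:
  assumes "skew_cluster_cyclic B"
  shows "skew_cluster_cyclic (mutate k B)"
proof -
  have "cyclic (B_mat (mutate k B) w)" if w: "w \<in> reduced_seqs" for w
  proof (cases "w \<noteq> [] \<and> hd w = k")
    case True
    then obtain v where "w = k # v"
      by (cases w) auto
    then show ?thesis
      using assms w by (simp add: B_mat_Cons mutate_involution reduced_Cons skew_cluster_cyclic_def cluster_cyclic_def)
  next
    case False
    then have "k # w \<in> reduced_seqs"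
      using w by (auto simp: reduced_Cons)
    then have "cyclic (B_mat B (k # w))"
      using assms unfolding skew_cluster_cyclic_def cluster_cyclic_def by blast
    then show ?thesis
      by (simp add: B_mat_Cons)
  qed
  then show ?thesis
    using assms by (simp add: skew_cluster_cyclic_def cluster_cyclic_def skew_mutate)
qed

lemma skew_cluster_cyclic_B_mat: "skew_cluster_cyclic B \<Longrightarrow> skew_cluster_cyclic (B_mat B w)"
  by (induction w rule: rev_induct) (simp_all add: B_mat_simps skew_cluster_cyclic_mutate)

lemma cyclic_uminus: "cyclic B \<Longrightarrow> cyclic (- B)"
proof -
  have "map_matrix sgn (- B) = - map_matrix sgn B"
    by (simp add: vec_eq_iff map_matrix_def sgn_minus)
  then show "cyclic B \<Longrightarrow> cyclic (- B)"
    by (auto simp: cyclic_def)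
qed

lemma skew_cluster_cyclic_uminus:
  assumes "skew_cluster_cyclic B"
  shows "skew_cluster_cyclic (- B)"
  using assms by (simp add: skew_cluster_cyclic_def cluster_cyclic_def skew_uminus B_mat_uminus cyclic_uminus)

text \<open>Products of consecutive entries express cyclicity for both orientations of the 3-cycle
  at once.\<close>

lemma cyclic_mult_pos:
  assumes "cyclic B" "x \<noteq> y" "y \<noteq> z" "x \<noteq> z"
  shows "B $ x $ y * B $ y $ z > 0"
proof -
  have "\<forall>x y z. x \<noteq> y \<longrightarrow> y \<noteq> z \<longrightarrow> x \<noteq> z \<longrightarrow> cyclic_sign $ x $ y * cyclic_sign $ y $ z > 0"
    by (simp add: cyclic_sign_def forall_3 vector_3)
  then have pos: "cyclic_sign $ x $ y * cyclic_sign $ y $ z > 0"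
    using assms(2-4) by blast
  have sgn: "sgn (B $ u $ v) = map_matrix sgn B $ u $ v" for u v
    by (simp add: map_matrix_def)
  have "sgn (B $ x $ y) * sgn (B $ y $ z) > 0"
    using assms(1) pos unfolding cyclic_def sgn by (elim disjE) (simp_all only: vector_uminus_component minus_mult_minus)
  then show ?thesis
    by (metis sgn_greater sgn_mult)
qed

lemma skew_cluster_cyclic_mult_pos:
  assumes "skew_cluster_cyclic B" "x \<noteq> y" "y \<noteq> z" "x \<noteq> z"
  shows "B $ x $ y * B $ y $ z > 0"
proof -
  have "cyclic (B_mat B [])"
    using assms(1) reduced_Nil unfolding skew_cluster_cyclic_def cluster_cyclic_def by blast
  then show ?thesis
    using cyclic_mult_pos assms by (simp add: B_mat_simps)
qed

section \<open>Lower bound for the entries of cluster-cyclic matrices\<close>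

lemma exists_third: "\<exists>z :: 3. z \<noteq> x \<and> z \<noteq> y"
proof (rule ccontr)
  assume "\<not> ?thesis"
  then have "\<forall>z. z = x \<or> z = y"
    by blast
  then show False
    unfolding forall_3 by auto
qed

text \<open>Mutation reverses the orientation of the 3-cycle. The new entry therefore has the sign
  of the product term, which must outweigh the old entry of opposite sign.\<close>

lemma abs_mutate_nth:
  assumes B: "skew_cluster_cyclic B" and d: "k \<noteq> x" "k \<noteq> y" "x \<noteq> y"
  shows "\<bar>mutate k B $ x $ y\<bar> = \<bar>B $ x $ k\<bar> * \<bar>B $ k $ y\<bar> - \<bar>B $ x $ y\<bar>"
proof -
  let ?M = "mutate k B"
  have skew: "skew B" "skew ?M"
    using B by (simp_all add: skew_mutate)
  have M: "?M $ x $ k = - B $ x $ k" "?M $ k $ y = - B $ k $ y"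
    "?M $ x $ y = B $ x $ y + B $ x $ k * max (B $ k $ y) 0 + max (- B $ x $ k) 0 * B $ k $ y"
    using d by (simp_all add: mutate_nth[OF skew(1)])
  have pos: "B $ x $ k * B $ k $ y > 0" "B $ k $ y * - B $ x $ y > 0" "- B $ k $ y * - ?M $ x $ y > 0"
    using skew_cluster_cyclic_mult_pos[OF B] skew_cluster_cyclic_mult_pos[OF skew_cluster_cyclic_mutate[OF B], of k y x k] d
      skewD[OF skew(1), of x y] skewD[OF skew(2), of x y] M(2) by (metis add.inverse_inverse)+
  then show ?thesis
    using M(3) by (cases "B $ x $ k > 0") (auto simp: zero_less_mult_iff abs_if mult_less_0_iff)
qed

text \<open>For \<open>p < 2\<close> the differences of \<open>f\<close> decrease. A negative
  difference would drive \<open>f\<close> below 0, so \<open>f\<close> is nondecreasing; but then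
  the differences fall by at least \<open>(2 - p) * f 0\<close> each time and become
  negative.\<close>

lemma positive_recurrence_ge_2:
  fixes f :: "nat \<Rightarrow> real"
  assumes pos: "\<And>n. f n > 0" and rec: "\<And>n. f (n + 2) = p * f (n + 1) - f n"
  shows "p \<ge> 2"
proof (rule ccontr)
  assume "\<not> p \<ge> 2"
  then have p: "2 - p > 0" by simp
  define d where "d n = f (n + 1) - f n" for n
  have d_Suc: "d (Suc n) = d n - (2 - p) * f (n + 1)" for n
    using rec[of n] by (simp add: d_def algebra_simps)
  have "decseq d"
    using p pos by (intro decseq_SucI) (simp add: d_Suc less_imp_le)
  have "d m \<ge> 0" for m
  proof (rule ccontr)
    assume neg: "\<not> d m \<ge> 0"
    have bound: "f (m + n) \<le> f m + of_nat n * d m" for n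
    proof (induction n)
      case (Suc n)
      have "d (m + n) \<le> d m"
        using \<open>decseq d\<close> by (simp add: decseq_def)
      with Suc show ?case
        by (simp add: d_def algebra_simps)
    qed simp
    obtain n :: nat where "of_nat n * (- d m) > f m"
      using neg reals_Archimedean3[of "- d m"] by auto
    then show False
      using bound[of n] pos[of "m + n"] by simp
  qed
  then have "incseq f"
    by (intro incseq_SucI) (simp add: d_def)
  have bound: "d n \<le> d 0 - of_nat n * ((2 - p) * f 0)" for n
  proof (induction n)
    case (Suc n)
    have "(2 - p) * f 0 \<le> (2 - p) * f (n + 1)"
      using \<open>incseq f\<close> p by (intro mult_left_mono) (simp_all add: incseq_def)
    with Suc show ?case
      by (simp add: d_Suc algebra_simps)
  qed simp
  obtain n :: nat where "of_nat n * ((2 - p) * f 0) > d 0"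
    using p pos[of 0] reals_Archimedean3[of "(2 - p) * f 0"] by auto
  then show False
    using bound[of n] \<open>d n \<ge> 0\<close> by simp
qed

text \<open>Mutations alternating between \<open>x\<close> and \<open>y\<close> keep
  \<open>\<bar>B $ x $ y\<bar>\<close> and make the entries towards the third index satisfy the
  recurrence of \<open>positive_recurrence_ge_2\<close>.\<close>

lemma abs_nth_ge_2:
  assumes B: "skew_cluster_cyclic B" and "x \<noteq> y"
  shows "\<bar>B $ x $ y\<bar> \<ge> 2"
proof -
  obtain z where z: "z \<noteq> x" "z \<noteq> y"
    using exists_third by blast
  define dir where "dir n = (if even n then x else y)" for n :: nat
  define M where "M n = B_mat B (map dir [0..<n])" for n
  have M_Suc: "M (Suc n) = mutate (dir n) (M n)" for n
    by (simp add: M_def B_mat_simps)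
  have scc: "skew_cluster_cyclic (M n)" for n
    using B by (simp add: M_def skew_cluster_cyclic_B_mat)
  have dir: "dir (Suc (Suc n)) = dir n" "dir n \<noteq> dir (Suc n)" "dir n \<noteq> z" for n
    using assms(2) z by (auto simp: dir_def)
  have neg: "M (Suc n) $ u $ v = - M n $ u $ v" if "u = dir n \<or> v = dir n" for n u v
    using that by (simp add: M_Suc mutate_nth scc)
  have p: "\<bar>M n $ dir (Suc n) $ dir n\<bar> = \<bar>B $ x $ y\<bar>" for n
  proof (induction n)
    case 0
    show ?case
      using skewD[of B y x] B by (simp add: dir_def M_def B_mat_simps)
  next
    case (Suc n)
    then show ?case
      using neg[of "dir n" n "dir (Suc n)"] skewD[OF skew_cluster_cyclic_skew[OF scc], of n "dir n" "dir (Suc n)"] by (simp add: dir)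
  qed
  \<comment> \<open>This is the size of the entry that the next mutation, at \<open>dir n\<close>,
    is about to change.\<close>
  define f where "f n = \<bar>M n $ dir (Suc n) $ z\<bar>" for n
  have "f n > 0" for n
    using skew_cluster_cyclic_mult_pos[OF scc, of "dir (Suc n)" z "dir n" n] dir[of n] dir(3)[of "Suc n"]
    by (auto simp: f_def)
  moreover have "f (n + 2) = \<bar>B $ x $ y\<bar> * f (n + 1) - f n" for n
  proof -
    have "f (n + 2) = \<bar>M (Suc n) $ dir (Suc n) $ z\<bar>"
      using neg[of "dir (Suc n)" "Suc n" z] by (simp add: f_def dir)
    also have "\<dots> = \<bar>M n $ dir (Suc n) $ dir n\<bar> * \<bar>M n $ dir n $ z\<bar> - \<bar>M n $ dir (Suc n) $ z\<bar>"
      unfolding M_Suc using dir[of n] dir(3)[of "Suc n"] by (intro abs_mutate_nth scc) auto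
    also have "\<bar>M n $ dir n $ z\<bar> = f (n + 1)"
      using neg[of "dir n" n z] by (simp add: f_def dir)
    finally show ?thesis
      by (simp add: p f_def)
  qed
  ultimately show ?thesis
    by (rule positive_recurrence_ge_2)
qed

section \<open>Sign-coherence of the C-pattern\<close>

text \<open>If column \<open>k\<close> is nonnegative, the last summand of the recurrence vanishes;
  if it is nonpositive, that summand turns \<open>max t 0\<close> into \<open>max (- t) 0\<close>,
  where \<open>t\<close> runs through row \<open>k\<close> of \<open>B_mat B w\<close>.\<close>

lemma C_mat_snoc:
  assumes "e \<in> {1, -1}" "\<And>r. 0 \<le> e * C_mat B w $ r $ k"
  shows "C_mat B (w @ [k]) = C_mat B w ** elem_mat e k (B_mat B w)"
proof -
  define C M where "C = C_mat B w" and "M = B_mat B w"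
  have "(C ** J k) $ r $ y = (if y = k then - C $ r $ k else C $ r $ y)" for r y
    by (simp add: matrix_matrix_mult_def J_def if_distrib cong: if_cong)
  moreover have "(C ** only_row k (pos_part M)) $ r $ y = C $ r $ k * max (M $ k $ y) 0" for r y
    by (simp add: matrix_matrix_mult_def only_row_def pos_part_def map_matrix_def if_distrib cong: if_cong)
  moreover have "(only_col k (pos_part (- C)) ** M) $ r $ y = max (- C $ r $ k) 0 * M $ k $ y" for r y
    by (simp add: matrix_matrix_mult_def only_col_def pos_part_def map_matrix_def if_distrib[of "\<lambda>t. t * _"] cong: if_cong)
  moreover have "max (- C $ r $ k) 0 = (if e = 1 then 0 else - C $ r $ k)" for r
    using assms by (auto simp: C_def)
  ultimately show ?thesis
    using assms(1) max_zero_conv_uminus[of "M $ k $ _"]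
    unfolding C_mat_simps vec_eq_iff mult_elem_nth C_def[symmetric] M_def[symmetric]
    by (auto simp: algebra_simps)
qed

text \<open>For sign -1 the last summand contributes column \<open>k\<close> of
  \<open>B ** C_mat B w\<close>, hence that of \<open>G_mat B w ** B_mat B w\<close>; it replaces
  the negative part of column \<open>k\<close> of \<open>B_mat B w\<close> by the positive
  part.\<close>

lemma G_mat_snoc:
  assumes "e \<in> {1, -1}" "\<And>r. 0 \<le> e * C_mat B w $ r $ k"
    and "skew B" "G_mat B w ** B_mat B w = B ** C_mat B w"
  shows "G_mat B (w @ [k]) = G_mat B w ** transpose (elem_mat e k (B_mat B w))"
proof -
  define C G M where "C = C_mat B w" and "G = G_mat B w" and "M = B_mat B w"
  have "J k + only_col k (pos_part (- M)) = transpose (elem_mat 1 k M)"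
    using skew_B_mat[OF assms(3), of w, folded M_def, unfolded skew_def, symmetric]
    by (auto simp: vec_eq_iff transpose_def elem_nth J_def only_col_def pos_part_def map_matrix_def)
  then have 1: "G ** J k + G ** only_col k (pos_part (- M)) = G ** transpose (elem_mat 1 k M)"
    by (metis matrix_add_ldistrib)
  show ?thesis
  proof (cases "e = 1")
    case True
    then have "only_col k (pos_part (- C)) = 0"
      using assms(2) by (auto simp: vec_eq_iff only_col_def pos_part_def map_matrix_def C_def)
    then show ?thesis
      using 1 True by (simp add: G_mat_simps C_def G_def M_def)
  next
    case False
    then have e: "e = -1"
      using assms(1) by simp
    then have "only_col k (pos_part (- C)) = - only_col k C"
      using assms(2) by (auto simp: vec_eq_iff only_col_def pos_part_def map_matrix_def C_def)
    moreover have mult_only_col: "A ** only_col k N = only_col k (A ** N)" for A N :: mat3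
      by (simp add: vec_eq_iff matrix_matrix_mult_def only_col_def)
    moreover have "transpose (elem_mat (-1) k M) = transpose (elem_mat 1 k M) + only_col k M"
    proof -
      have "transpose (elem_mat (-1) k M) $ x $ y =
          transpose (elem_mat 1 k M) $ x $ y + (if y = k then max (- M $ k $ x) 0 - max (M $ k $ x) 0 else 0)" for x y
        by (simp add: transpose_def elem_nth)
      moreover have "max (- M $ k $ x) 0 - max (M $ k $ x) 0 = M $ x $ k" for x
        using skewD[OF skew_B_mat[OF assms(3), of w, folded M_def], of x k] by linarith
      ultimately show ?thesis
        by (simp add: vec_eq_iff only_col_def)
    qed
    moreover have "B ** - N = - (B ** N)" for N :: mat3
      by (simp add: vec_eq_iff matrix_matrix_mult_def sum_negf)
    ultimately show ?thesis
      using 1 e assms(4) by (simp add: G_mat_simps C_def[symmetric] G_def[symmetric] M_def[symmetric] matrix_add_ldistrib)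
  qed
qed

text \<open>The roles of the three indices after mutating at \<open>K\<close>: the columns \<open>K\<close> and \<open>j\<close> of \<open>C\<close> have
  opposite signs and \<open>K\<close> is to be added to \<open>j\<close>, whose entries dominate. Together with
  \<open>abs_nth_ge_2\<close> the domination makes the sign-coherence survive a mutation at \<open>j\<close>, the only case
  in which vectors of opposite signs are added.\<close>

definition seed_state :: "mat3 \<Rightarrow> mat3 \<Rightarrow> 3 \<Rightarrow> 3 \<Rightarrow> 3 \<Rightarrow> real \<Rightarrow> real \<Rightarrow> bool" where
  "seed_state B C K j i e e' \<longleftrightarrow>
     K \<noteq> j \<and> j \<noteq> i \<and> K \<noteq> i \<and> e \<in> {1, -1} \<and> e' \<in> {1, -1} \<and> 0 < - e * B $ K $ j \<and>
     (\<forall>r. 0 \<le> - e * C $ r $ K \<and> - e * C $ r $ K \<le> e * C $ r $ j \<and> 0 \<le> e' * C $ r $ i)"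

section \<open>Propagation of the state under mutation\<close>

lemma exhaust_3_distinct:
  fixes x :: 3
  assumes "K \<noteq> j" "j \<noteq> i" "K \<noteq> i"
  shows "x = K \<or> x = j \<or> x = i"
proof -
  have "\<forall>K j i x :: 3. K \<noteq> j \<longrightarrow> j \<noteq> i \<longrightarrow> K \<noteq> i \<longrightarrow> x = K \<or> x = j \<or> x = i"
    unfolding forall_3 by simp
  then show ?thesis
    using assms by blast
qed

text \<open>At least twice column \<open>j\<close> is added to column \<open>K\<close> of opposite
  sign. As \<open>j\<close> dominates \<open>K\<close>, the sum takes the sign of \<open>j\<close>
  and dominates it in turn. The orientation of the 3-cycle leaves column \<open>i\<close>
  unchanged.\<close>

lemma seed_state_mutate_j:
  assumes B: "skew_cluster_cyclic B" and S: "seed_state B C K j i e e'"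
  defines "C' \<equiv> C ** elem_mat e j B"
  shows "seed_state (mutate j B) C' j K i e e'" "y \<noteq> K \<Longrightarrow> \<bar>C' $ r $ y\<bar> = \<bar>C $ r $ y\<bar>"
proof -
  have d: "K \<noteq> j" "j \<noteq> i" "K \<noteq> i" and e: "e \<in> {1, -1}" "e' \<in> {1, -1}" and o: "0 < - e * B $ K $ j"
    and C: "0 \<le> - e * C $ r $ K" "- e * C $ r $ K \<le> e * C $ r $ j" "0 \<le> e' * C $ r $ i" for r
    using S by (auto simp: seed_state_def)
  have jK: "B $ j $ K = - B $ K $ j"
    by (rule skewD) (simp add: B)
  have ge: "e * B $ j $ K \<ge> 2"
    using abs_nth_ge_2[OF B, of K j] d(1) e o jK by auto
  have ji: "e * B $ j $ i \<le> 0"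
    using skew_cluster_cyclic_mult_pos[OF B, of K j i] d e o by (auto simp: zero_less_mult_iff)
  have C'j: "C' $ r $ j = - C $ r $ j" and C'i: "C' $ r $ i = C $ r $ i"
    and C'K: "C' $ r $ K = C $ r $ K + C $ r $ j * (e * B $ j $ K)" for r
    using d ji ge B by (simp_all add: C'_def mult_elem_nth)
  have "e * C $ r $ j \<le> e * C' $ r $ K" for r
  proof -
    have "2 * (e * C $ r $ j) \<le> (e * B $ j $ K) * (e * C $ r $ j)"
      using C[of r] ge by (intro mult_right_mono) auto
    moreover have "e * C' $ r $ K = e * C $ r $ K + (e * B $ j $ K) * (e * C $ r $ j)"
      unfolding C'K by (simp add: algebra_simps)
    ultimately show ?thesis
      using C[of r] by linarith
  qed
  moreover have "0 \<le> e * C $ r $ j" for r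
    using C[of r] by linarith
  moreover have "mutate j B $ j $ K = - B $ j $ K"
    using B by (simp add: mutate_nth)
  ultimately show "seed_state (mutate j B) C' j K i e e'"
    using d e ge C by (auto simp: seed_state_def C'j C'i)
  show "\<bar>C' $ r $ y\<bar> = \<bar>C $ r $ y\<bar>" if "y \<noteq> K"
    using exhaust_3_distinct[OF d, of y] that by (auto simp: C'j C'i)
qed

text \<open>Columns \<open>i\<close> and \<open>j\<close> share their sign and only \<open>j\<close>
  receives a multiple of \<open>i\<close>, so nothing cancels; a coefficient of at least 1 gives the
  domination.\<close>

lemma seed_state_mutate_i_same:
  assumes B: "skew_cluster_cyclic B" and S: "seed_state B C K j i e e"
  defines "C' \<equiv> C ** elem_mat e i B"
  shows "seed_state (mutate i B) C' i j K e (- e)" "y \<noteq> j \<Longrightarrow> \<bar>C' $ r $ y\<bar> = \<bar>C $ r $ y\<bar>"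
proof -
  have d: "K \<noteq> j" "j \<noteq> i" "K \<noteq> i" and e: "e \<in> {1, -1}" and o: "0 < - e * B $ K $ j"
    and C: "0 \<le> - e * C $ r $ K" "- e * C $ r $ K \<le> e * C $ r $ j" "0 \<le> e * C $ r $ i" for r
    using S by (auto simp: seed_state_def)
  have ij: "B $ i $ j = - B $ j $ i"
    by (rule skewD) (simp add: B)
  have "e * B $ j $ i < 0"
    using skew_cluster_cyclic_mult_pos[OF B, of K j i] d e o by (auto simp: zero_less_mult_iff)
  then have ge: "e * B $ i $ j \<ge> 2"
    using abs_nth_ge_2[OF B, of i j] d e ij by auto
  have iK: "e * B $ i $ K \<le> 0"
    using skew_cluster_cyclic_mult_pos[OF B, of i K j] d e o by (auto simp: zero_less_mult_iff)
  have C'i: "C' $ r $ i = - C $ r $ i" and C'K: "C' $ r $ K = C $ r $ K"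
    and C'j: "C' $ r $ j = C $ r $ j + C $ r $ i * (e * B $ i $ j)" for r
    using d iK ge B by (simp_all add: C'_def mult_elem_nth)
  have "e * C $ r $ i \<le> e * C' $ r $ j" for r
  proof -
    have "1 * (e * C $ r $ i) \<le> (e * B $ i $ j) * (e * C $ r $ i)"
      using C[of r] ge by (intro mult_right_mono) auto
    moreover have "e * C' $ r $ j = e * C $ r $ j + (e * B $ i $ j) * (e * C $ r $ i)"
      unfolding C'j by (simp add: algebra_simps)
    ultimately show ?thesis
      using C[of r] by linarith
  qed
  moreover have "mutate i B $ i $ j = - B $ i $ j"
    using B by (simp add: mutate_nth)
  ultimately show "seed_state (mutate i B) C' i j K e (- e)"
    using d e ge C by (auto simp: seed_state_def C'K C'i)
  show "\<bar>C' $ r $ y\<bar> = \<bar>C $ r $ y\<bar>" if "y \<noteq> j"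
    using exhaust_3_distinct[OF d, of y] that by (auto simp: C'K C'i)
qed

text \<open>Now column \<open>i\<close> shares its sign with \<open>K\<close>, which alone receives
  a multiple of it and takes over the role of \<open>j\<close>.\<close>

lemma seed_state_mutate_i_opposite:
  assumes B: "skew_cluster_cyclic B" and S: "seed_state B C K j i e (- e)"
  defines "C' \<equiv> C ** elem_mat (- e) i B"
  shows "seed_state (mutate i B) C' i K j (- e) e" "y \<noteq> K \<Longrightarrow> \<bar>C' $ r $ y\<bar> = \<bar>C $ r $ y\<bar>"
proof -
  have d: "K \<noteq> j" "j \<noteq> i" "K \<noteq> i" and e: "e \<in> {1, -1}" and o: "0 < - e * B $ K $ j"
    and C: "0 \<le> - e * C $ r $ K" "- e * C $ r $ K \<le> e * C $ r $ j" "0 \<le> - e * C $ r $ i" for r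
    using S by (auto simp: seed_state_def)
  have ij: "B $ i $ j = - B $ j $ i"
    by (rule skewD) (simp add: B)
  have "e * B $ j $ i < 0"
    using skew_cluster_cyclic_mult_pos[OF B, of K j i] d e o by (auto simp: zero_less_mult_iff)
  then have ij: "- e * B $ i $ j \<le> 0"
    using ij by simp
  have "e * B $ i $ K < 0"
    using skew_cluster_cyclic_mult_pos[OF B, of i K j] d e o by (auto simp: zero_less_mult_iff)
  then have ge: "- e * B $ i $ K \<ge> 2"
    using abs_nth_ge_2[OF B, of i K] d e by auto
  have C'i: "C' $ r $ i = - C $ r $ i" and C'j: "C' $ r $ j = C $ r $ j"
    and C'K: "C' $ r $ K = C $ r $ K + C $ r $ i * (- e * B $ i $ K)" for r
    using d ij ge B by (simp_all add: C'_def mult_elem_nth)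
  have "- e * C $ r $ i \<le> - e * C' $ r $ K" for r
  proof -
    have "1 * (- e * C $ r $ i) \<le> (- e * B $ i $ K) * (- e * C $ r $ i)"
      using C[of r] ge by (intro mult_right_mono) auto
    moreover have "- e * C' $ r $ K = - e * C $ r $ K + (- e * B $ i $ K) * (- e * C $ r $ i)"
      unfolding C'K by (simp add: algebra_simps)
    ultimately show ?thesis
      using C[of r] by linarith
  qed
  moreover have "mutate i B $ i $ K = - B $ i $ K"
    using B by (simp add: mutate_nth)
  moreover have "0 \<le> e * C $ r $ j" for r
    using C[of r] by linarith
  ultimately show "seed_state (mutate i B) C' i K j (- e) e"
    using d e ge C by (auto simp: seed_state_def C'j C'i)
  show "\<bar>C' $ r $ y\<bar> = \<bar>C $ r $ y\<bar>" if "y \<noteq> K"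
    using exhaust_3_distinct[OF d, of y] that by (auto simp: C'j C'i)
qed

lemma seed_state_mutate:
  assumes B: "skew_cluster_cyclic B" and S: "seed_state B C K j i e e'" and "x \<noteq> K"
  obtains \<epsilon> j' i' \<delta> \<delta>' where "\<epsilon> \<in> {1, -1}" "\<And>r. 0 \<le> \<epsilon> * C $ r $ x"
    "seed_state (mutate x B) (C ** elem_mat \<epsilon> x B) x j' i' \<delta> \<delta>'"
    "\<And>r y. y \<noteq> j' \<Longrightarrow> \<bar>(C ** elem_mat \<epsilon> x B) $ r $ y\<bar> = \<bar>C $ r $ y\<bar>"
proof -
  have d: "K \<noteq> j" "j \<noteq> i" "K \<noteq> i" and e: "e \<in> {1, -1}" "e' = e \<or> e' = - e"
    and C: "0 \<le> - e * C $ r $ K" "- e * C $ r $ K \<le> e * C $ r $ j" "0 \<le> e' * C $ r $ i" for r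
    using S by (auto simp: seed_state_def)
  have Cj: "0 \<le> e * C $ r $ j" for r
    using C[of r] by linarith
  consider "x = j" | "x = i" "e' = e" | "x = i" "e' = - e"
    using exhaust_3_distinct[OF d, of x] assms(3) e(2) by blast
  then show thesis
  proof cases
    case 1
    then show thesis
      using that[of e] e seed_state_mutate_j[OF B S] Cj by blast
  next
    case 2
    then show thesis
      using that[of e] e C(3) seed_state_mutate_i_same[OF B, of C K j i e] S by blast
  next
    case 3
    then show thesis
      using that[of "- e"] e C(3) seed_state_mutate_i_opposite[OF B, of C K j i e] S by fastforce
  qed
qed

text \<open>Row \<open>k\<close> of \<open>B\<close> has one positive and one negative entry off the
  diagonal. Only the column of the positive one changes, and its new entry of at least 2 dominates
  the -1 in column \<open>k\<close>.\<close>

lemma seed_state_initial: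
  assumes B: "skew_cluster_cyclic B"
  obtains j i where "seed_state (mutate k B) (elem_mat 1 k B) k j i 1 1"
    "\<And>r y. y \<noteq> j \<Longrightarrow> \<bar>elem_mat 1 k B $ r $ y\<bar> = \<bar>mat 1 $ r $ y\<bar>"
proof -
  obtain x where x: "x \<noteq> k"
    using exists_third by blast
  obtain y where y: "y \<noteq> k" "y \<noteq> x"
    using exists_third by blast
  have "B $ x $ k * B $ k $ y > 0"
    using skew_cluster_cyclic_mult_pos[OF B] x y by auto
  moreover have "B $ x $ k = - B $ k $ x"
    by (rule skewD) (simp add: B)
  ultimately have "B $ k $ x > 0 \<and> B $ k $ y < 0 \<or> B $ k $ y > 0 \<and> B $ k $ x < 0"
    by (auto simp: mult_less_0_iff)
  then obtain j i where ji: "k \<noteq> j" "k \<noteq> i" "j \<noteq> i" "B $ k $ j > 0" "B $ k $ i < 0"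
    using x y by metis
  have "\<bar>B $ k $ j\<bar> \<ge> 2"
    using abs_nth_ge_2[OF B, of k j] ji by auto
  then have "seed_state (mutate k B) (elem_mat 1 k B) k j i 1 1"
    using ji B by (auto simp: seed_state_def elem_nth mutate_nth max_def)
  moreover have "\<bar>elem_mat 1 k B $ r $ y\<bar> = \<bar>mat 1 $ r $ y\<bar>" if "y \<noteq> j" for r y
    using exhaust_3_distinct[of k j i y] ji that B by (auto simp: elem_nth mat_def)
  ultimately show thesis
    using that by blast
qed

text \<open>Sums of columns of opposite signs are controlled by domination, so the induction carries
  the whole state. Reducedness rules out mutating twice at one index, which
  \<open>seed_state_mutate\<close> excludes. The clause on absolute values serves
  \<open>C_mat_column_multiple_of_unit\<close>.\<close>

lemma C_mat_snoc_state:
  assumes B: "skew_cluster_cyclic B"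
  shows "w @ [x] \<in> reduced_seqs \<Longrightarrow> \<exists>\<epsilon> j i e e'. \<epsilon> \<in> {1, -1} \<and> (\<forall>r. 0 \<le> \<epsilon> * C_mat B w $ r $ x) \<and>
    seed_state (B_mat B (w @ [x])) (C_mat B (w @ [x])) x j i e e' \<and>
    (\<forall>r y. y \<noteq> j \<longrightarrow> \<bar>C_mat B (w @ [x]) $ r $ y\<bar> = \<bar>C_mat B w $ r $ y\<bar>)"
proof (induction w arbitrary: x rule: rev_induct)
  case Nil
  obtain j i where "seed_state (mutate x B) (elem_mat 1 x B) x j i 1 1"
    "\<And>r y. y \<noteq> j \<Longrightarrow> \<bar>elem_mat 1 x B $ r $ y\<bar> = \<bar>mat 1 $ r $ y\<bar>"
    using seed_state_initial[OF B] by blast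
  moreover have "C_mat B ([] @ [x]) = C_mat B [] ** elem_mat 1 x (B_mat B [])"
    by (rule C_mat_snoc) (simp_all add: C_mat_simps(1) mat_def)
  then have "C_mat B ([] @ [x]) = elem_mat 1 x B"
    by (simp only: C_mat_simps(1) B_mat_simps(1) matrix_mul_lid)
  moreover have "B_mat B ([] @ [x]) = mutate x B" "C_mat B [] = mat 1"
    by (simp_all only: B_mat_simps C_mat_simps)
  moreover have "\<forall>r. 0 \<le> 1 * (mat 1 :: mat3) $ r $ x"
    by (simp add: mat_def)
  ultimately show ?case
    by (metis insertI1)
next
  case (snoc k w)
  let ?w = "w @ [k]"
  have "x \<noteq> k" and red: "w @ [k] \<in> reduced_seqs"
    using snoc.prems by (simp_all add: reduced_snoc del: append_assoc)
  obtain j i e e' where S: "seed_state (B_mat B ?w) (C_mat B ?w) k j i e e'"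
    using snoc.IH[OF red] by blast
  obtain \<epsilon> j' i' \<delta> \<delta>' where *: "\<epsilon> \<in> {1, -1}" "\<And>r. 0 \<le> \<epsilon> * C_mat B ?w $ r $ x"
    "seed_state (mutate x (B_mat B ?w)) (C_mat B ?w ** elem_mat \<epsilon> x (B_mat B ?w)) x j' i' \<delta> \<delta>'"
    "\<And>r y. y \<noteq> j' \<Longrightarrow> \<bar>(C_mat B ?w ** elem_mat \<epsilon> x (B_mat B ?w)) $ r $ y\<bar> = \<bar>C_mat B ?w $ r $ y\<bar>"
    using seed_state_mutate[OF skew_cluster_cyclic_B_mat[OF B] S \<open>x \<noteq> k\<close>] by metis
  have "C_mat B (?w @ [x]) = C_mat B ?w ** elem_mat \<epsilon> x (B_mat B ?w)" "B_mat B (?w @ [x]) = mutate x (B_mat B ?w)"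
    using C_mat_snoc[OF *(1,2)] B_mat_simps(2)[of B ?w x] by blast+
  then show ?case
    using * by metis
qed

section \<open>Column signs, and duality of C and G\<close>

lemma C_mat_last_state:
  assumes "skew_cluster_cyclic B" "w \<in> reduced_seqs" "w \<noteq> []"
  obtains j i e e' where "seed_state (B_mat B w) (C_mat B w) (last w) j i e e'"
  using C_mat_snoc_state[OF assms(1), of "butlast w" "last w"] assms(2,3) by auto

lemma C_mat_sign_coherent:
  assumes B: "skew_cluster_cyclic B" and w: "w \<in> reduced_seqs"
  obtains \<epsilon> where "\<epsilon> \<in> {1, -1}" "\<And>r. 0 \<le> \<epsilon> * C_mat B w $ r $ x"
proof (cases "w = []")
  case True
  then show thesis
    using that[of 1] by (simp add: C_mat_simps mat_def)
next
  case False
  then obtain j i e e' where S: "seed_state (B_mat B w) (C_mat B w) (last w) j i e e'"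
    using C_mat_last_state[OF assms] by blast
  then have d: "last w \<noteq> j" "j \<noteq> i" "last w \<noteq> i" and e: "e \<in> {1, -1}" "e' \<in> {1, -1}"
    and C: "0 \<le> - e * C_mat B w $ r $ last w" "- e * C_mat B w $ r $ last w \<le> e * C_mat B w $ r $ j"
       "0 \<le> e' * C_mat B w $ r $ i" for r
    by (auto simp: seed_state_def)
  have "0 \<le> e * C_mat B w $ r $ j" for r
    using C[of r] by linarith
  then show thesis
    using exhaust_3_distinct[OF d, of x] that[of e] that[of "- e"] that[of e'] e C by fastforce
qed

text \<open>Columns \<open>K\<close> and \<open>j\<close> of a state have opposite signs. This will
  separate the C-matrices of nonempty sequences from the identity.\<close>

lemma C_mat_nonpos_column:
  assumes B: "skew_cluster_cyclic B" and w: "w \<in> reduced_seqs" "w \<noteq> []"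
  obtains x where "\<And>r. C_mat B w $ r $ x \<le> 0"
proof -
  obtain j i e e' where S: "seed_state (B_mat B w) (C_mat B w) (last w) j i e e'"
    using C_mat_last_state[OF assms] by blast
  then have e: "e \<in> {1, -1}"
    and C: "0 \<le> - e * C_mat B w $ r $ last w" "- e * C_mat B w $ r $ last w \<le> e * C_mat B w $ r $ j" for r
    by (auto simp: seed_state_def)
  have "0 \<le> e * C_mat B w $ r $ j" for r
    using C[of r] by linarith
  then show thesis
    using that[of "last w"] that[of j] e C by force
qed

text \<open>Each mutation multiplies C by an involution and G by its transpose. The second identity
  is proved along because \<open>G_mat_snoc\<close> relies on it.\<close>

lemma C_G_duality:
  assumes B: "skew_cluster_cyclic B"
  shows "w \<in> reduced_seqs \<Longrightarrow> transpose (C_mat B w) ** G_mat B w = mat 1 \<and> G_mat B w ** B_mat B w = B ** C_mat B w"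
proof (induction w rule: rev_induct)
  case Nil
  show ?case
    by (simp add: C_mat_simps G_mat_simps B_mat_simps)
next
  case (snoc k w)
  have w: "w \<in> reduced_seqs"
    using snoc.prems by (simp add: reduced_snoc)
  obtain \<epsilon> where \<epsilon>: "\<epsilon> \<in> {1, -1}" "\<And>r. 0 \<le> \<epsilon> * C_mat B w $ r $ k"
    using C_mat_sign_coherent[OF B w] by blast
  have IH: "transpose (C_mat B w) ** G_mat B w = mat 1" "G_mat B w ** B_mat B w = B ** C_mat B w"
    using snoc.IH[OF w] by blast+
  have skew: "skew (B_mat B w)"
    by (simp add: B skew_B_mat)
  have C: "C_mat B (w @ [k]) = C_mat B w ** elem_mat \<epsilon> k (B_mat B w)" and G: "G_mat B (w @ [k]) = G_mat B w ** transpose (elem_mat \<epsilon> k (B_mat B w))"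
    using C_mat_snoc[OF \<epsilon>] G_mat_snoc[OF \<epsilon> _ IH(2)] B by simp_all
  have "transpose (C_mat B (w @ [k])) ** G_mat B (w @ [k]) =
      transpose (elem_mat \<epsilon> k (B_mat B w)) ** (transpose (C_mat B w) ** G_mat B w) ** transpose (elem_mat \<epsilon> k (B_mat B w))"
    by (simp add: C G matrix_transpose_mul matrix_mul_assoc)
  then have 1: "transpose (C_mat B (w @ [k])) ** G_mat B (w @ [k]) = mat 1"
    by (simp add: IH transpose_elem_involution[OF skew])
  have "G_mat B (w @ [k]) ** B_mat B (w @ [k]) = G_mat B w ** B_mat B w ** elem_mat \<epsilon> k (B_mat B w)"
    by (simp add: G B_mat_simps mutate_eq_elem[OF skew \<epsilon>(1)] matrix_mul_assoc transpose_elem_mult_cancel[OF skew])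
  then have "G_mat B (w @ [k]) ** B_mat B (w @ [k]) = B ** C_mat B (w @ [k])"
    by (simp add: IH C matrix_mul_assoc)
  with 1 show ?case by blast
qed

section \<open>Change of the initial seed\<close>

lemma sum_UNIV_single:
  fixes f :: "'a::finite \<Rightarrow> 'b::comm_monoid_add"
  assumes "\<And>r. r \<noteq> k \<Longrightarrow> f r = 0"
  shows "sum f UNIV = f k"
proof -
  have "sum f UNIV = sum f {k}"
    using assms by (intro sum.mono_neutral_right) auto
  then show ?thesis
    by simp
qed

lemma C_G_column_sum:
  assumes "skew_cluster_cyclic B" "w \<in> reduced_seqs"
  shows "(\<Sum>r\<in>UNIV. C_mat B w $ r $ x * G_mat B w $ r $ y) = (if x = y then 1 else 0)"
proof -
  have "(transpose (C_mat B w) ** G_mat B w) $ x $ y = (mat 1 :: mat3) $ x $ y"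
    using C_G_duality[OF assms] by simp
  then show ?thesis
    by (simp add: matrix_matrix_mult_def transpose_def mat_def)
qed

lemma C_G_row_sum:
  assumes "skew_cluster_cyclic B" "w \<in> reduced_seqs"
  shows "(\<Sum>y\<in>UNIV. G_mat B w $ r $ y * C_mat B w $ s $ y) = (if r = s then 1 else 0)"
proof -
  have "G_mat B w ** transpose (C_mat B w) = mat 1"
    using C_G_duality[OF assms] matrix_left_right_inverse by blast
  then have "(G_mat B w ** transpose (C_mat B w)) $ r $ s = (mat 1 :: mat3) $ r $ s"
    by simp
  then show ?thesis
    by (simp add: matrix_matrix_mult_def transpose_def mat_def)
qed

text \<open>A step changes only column \<open>j\<close> in absolute value; other columns are traced
  back to a shorter sequence. Column \<open>j\<close> itself dominates the last mutated column, so
  both would be multiples of the same unit vector and C would be singular.\<close>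

lemma C_mat_column_multiple_of_unit:
  assumes B: "skew_cluster_cyclic B"
  shows "w \<in> reduced_seqs \<Longrightarrow> (\<And>r. r \<noteq> k \<Longrightarrow> C_mat B w $ r $ x = 0) \<Longrightarrow> \<bar>C_mat B w $ k $ x\<bar> = 1"
proof (induction w rule: rev_induct)
  case Nil
  have "x = k"
    using Nil(2)[of x] by (auto simp: C_mat_simps mat_def)
  then show ?case
    by (simp add: C_mat_simps mat_def)
next
  case (snoc l w)
  let ?C = "C_mat B (w @ [l])" and ?G = "G_mat B (w @ [l])"
  obtain j i e e' where S: "seed_state (B_mat B (w @ [l])) ?C l j i e e'"
    and abs: "\<And>r y. y \<noteq> j \<Longrightarrow> \<bar>?C $ r $ y\<bar> = \<bar>C_mat B w $ r $ y\<bar>"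
    using C_mat_snoc_state[OF B snoc.prems(1)] by metis
  have w: "w \<in> reduced_seqs"
    using snoc.prems(1) by (simp add: reduced_snoc)
  show ?case
  proof (cases "x = j")
    case False
    then have "C_mat B w $ r $ x = 0" if "r \<noteq> k" for r
      using snoc.prems(2)[OF that] abs[of x r] by simp
    then show ?thesis
      using snoc.IH[OF w] abs[OF False, of k] by simp
  next
    case True
    have "?C $ r $ l = 0" if "r \<noteq> k" for r
    proof -
      have "e \<in> {1, -1}" "0 \<le> - e * ?C $ r $ l" "- e * ?C $ r $ l \<le> e * ?C $ r $ j"
        using S by (auto simp: seed_state_def)
      then show ?thesis
        using snoc.prems(2)[OF that] True by auto
    qed
    then have "?C $ k $ l * ?G $ k $ l = 1" "?C $ k $ l * ?G $ k $ j = 0"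
      using C_G_column_sum[OF B snoc.prems(1), of l l] C_G_column_sum[OF B snoc.prems(1), of l j]
        sum_UNIV_single[of k "\<lambda>r. ?C $ r $ l * ?G $ r $ _"] S
      by (simp_all add: seed_state_def)
    moreover have "?C $ k $ j * ?G $ k $ j = 1"
      using C_G_column_sum[OF B snoc.prems(1), of j j] snoc.prems(2) True
        sum_UNIV_single[of k "\<lambda>r. ?C $ r $ j * ?G $ r $ j"]
      by simp
    ultimately show ?thesis
      by auto
  qed
qed

lemma transpose_C_B_C:
  assumes "skew_cluster_cyclic B" "w \<in> reduced_seqs"
  shows "transpose (C_mat B w) ** B ** C_mat B w = B_mat B w"
  using C_G_duality[OF assms] by (metis matrix_mul_assoc matrix_mul_lid)

text \<open>The two signs for an elementary matrix differ by a matrix of rank one. When a column of \<open>C\<close> is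
  \<open>\<plusminus> e\<^sub>k\<close>, the rank one terms on both sides of \<open>C\<close> agree because of \<open>C\<^sup>T B C = B\<^sup>w\<close>.\<close>

lemma elem_mult_switch:
  assumes B: "skew B" and M: "skew M" and CBC: "transpose C ** B ** C = M"
    and \<delta>: "\<delta> \<in> {1, -1}" and C: "\<And>r. C $ r $ x = (if r = k then \<delta> else 0)"
  shows "elem_mat (- \<delta>) k B ** C ** elem_mat (- \<delta>) x M = elem_mat \<delta> k B ** C ** elem_mat \<delta> x M"
proof -
  \<comment> \<open>Column \<open>x\<close> of \<open>C\<close> is \<delta> times the
    \<open>k\<close>-th unit vector, so row \<open>x\<close> of \<open>C\<^sup>T B C\<close> is
    \<delta> times row \<open>k\<close> of \<open>B C\<close>.\<close>
  have row: "\<delta> * (\<Sum>z\<in>UNIV. B $ k $ z * C $ z $ y) = M $ x $ y" for y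
  proof -
    have "M $ x $ y = (transpose C ** (B ** C)) $ x $ y"
      by (simp add: CBC[symmetric] matrix_mul_assoc)
    also have "\<dots> = (\<Sum>r\<in>UNIV. C $ r $ x * (B ** C) $ r $ y)"
      by (simp add: matrix_matrix_mult_def transpose_def)
    also have "\<dots> = \<delta> * (B ** C) $ k $ y"
      by (subst sum_UNIV_single[of k]) (simp_all add: C)
    finally show ?thesis
      by (simp add: matrix_matrix_mult_def)
  qed
  define S where "S e y = (\<Sum>z\<in>UNIV. max (e * B $ k $ z) 0 * C $ z $ y)" for e y
  have S: "S \<delta> y = S (- \<delta>) y + M $ x $ y" for y
  proof -
    have "max (\<delta> * B $ k $ z) 0 * C $ z $ y - max (- \<delta> * B $ k $ z) 0 * C $ z $ y = \<delta> * (B $ k $ z * C $ z $ y)" for z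
      using max_zero_conv_uminus[of "\<delta> * B $ k $ z"] by (simp add: algebra_simps)
    then have "S \<delta> y - S (- \<delta>) y = (\<Sum>z\<in>UNIV. \<delta> * (B $ k $ z * C $ z $ y))"
      unfolding S_def sum_subtractf[symmetric] by simp
    also have "\<dots> = M $ x $ y"
      using row[of y] by (simp add: sum_distrib_left)
    finally show ?thesis
      by simp
  qed
  have S0: "S e x = 0" for e
    unfolding S_def using B by (subst sum_UNIV_single[of k]) (simp_all add: C)
  have "(elem_mat (- \<delta>) k B ** C ** elem_mat (- \<delta>) x M) $ r $ y = (elem_mat \<delta> k B ** C ** elem_mat \<delta> x M) $ r $ y" for r y
  proof -
    define t where "t = max (- \<delta> * M $ x $ y) 0"
    have t: "max (\<delta> * M $ x $ y) 0 = \<delta> * M $ x $ y + t"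
      using max_zero_conv_uminus[of "\<delta> * M $ x $ y"] by (simp add: t_def)
    show ?thesis
      unfolding mult_elem_nth elem_mult_nth S_def[symmetric] t t_def[symmetric]
      unfolding C S0 using \<delta> M S[of y] by (auto simp: algebra_simps)
  qed
  then show ?thesis
    by (simp add: vec_eq_iff)
qed

text \<open>Append \<open>x\<close> from both initial seeds. The left factor affects only row
  \<open>k\<close>, so column \<open>x\<close> has the same sign in both C-matrices unless it is a
  multiple of the \<open>k\<close>-th unit vector; then \<open>elem_mult_switch\<close> flips the
  sign of the left factor. Coherence of the G-rows is assumed only up to the length of
  \<open>u\<close>, as it will come from an induction that uses this lemma.\<close>

lemma C_mat_Cons:
  assumes B: "skew_cluster_cyclic B"
    and coh: "\<And>v. v \<in> reduced_seqs \<Longrightarrow> length v \<le> length u \<Longrightarrow>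
      \<exists>\<tau>\<in>{1, -1}. \<forall>y. 0 \<le> \<tau> * G_mat (mutate k B) v $ k $ y"
    and red: "k # u \<in> reduced_seqs"
  shows "\<exists>\<eta>\<in>{1, -1}. C_mat B (k # u) = elem_mat \<eta> k B ** C_mat (mutate k B) u \<and> (\<forall>y. 0 \<le> \<eta> * G_mat (mutate k B) u $ k $ y)"
  using coh red
proof (induction u rule: rev_induct)
  case Nil
  have "C_mat B ([] @ [k]) = C_mat B [] ** elem_mat 1 k (B_mat B [])"
    by (rule C_mat_snoc) (simp_all add: C_mat_simps(1) mat_def)
  then have "C_mat B [k] = elem_mat 1 k B"
    by (simp add: C_mat_simps(1) B_mat_simps(1))
  then show ?case
    by (intro bexI[of _ 1]) (simp_all add: C_mat_simps(1) G_mat_simps(1), simp add: mat_def)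
next
  case (snoc x u)
  let ?B1 = "mutate k B"
  define M C D G G' where "M = B_mat B (k # u)" and "C = C_mat ?B1 u"
    and "D = C_mat B (k # u)" and "G = G_mat ?B1 u" and "G' = G_mat ?B1 (u @ [x])"
  have B1: "skew_cluster_cyclic ?B1"
    using B by (rule skew_cluster_cyclic_mutate)
  have M1: "B_mat ?B1 u = M"
    by (simp add: M_def B_mat_Cons)
  have M: "skew M"
    using B by (simp add: M_def skew_B_mat)
  have "(k # u) @ [x] \<in> reduced_seqs"
    using snoc.prems(2) by simp
  then have ku: "k # u \<in> reduced_seqs"
    by (simp only: reduced_snoc)
  then have u: "u \<in> reduced_seqs"
    by (simp add: reduced_Cons)
  have ux: "u @ [x] \<in> reduced_seqs"
    using snoc.prems(2) by (simp add: reduced_Cons)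
  obtain \<eta> where \<eta>: "\<eta> \<in> {1, -1}" "D = elem_mat \<eta> k B ** C" "\<And>y. 0 \<le> \<eta> * G $ k $ y"
    using snoc.IH[OF _ ku] snoc.prems(1) unfolding D_def C_def G_def by fastforce
  obtain \<epsilon> where \<epsilon>: "\<epsilon> \<in> {1, -1}" "\<And>r. 0 \<le> \<epsilon> * D $ r $ x"
    using C_mat_sign_coherent[OF B ku] unfolding D_def by blast
  obtain \<epsilon>' where \<epsilon>': "\<epsilon>' \<in> {1, -1}" "\<And>r. 0 \<le> \<epsilon>' * C $ r $ x"
    using C_mat_sign_coherent[OF B1 u] unfolding C_def by blast
  obtain \<tau> where \<tau>: "\<tau> \<in> {1, -1}" "\<And>y. 0 \<le> \<tau> * G' $ k $ y"
    using snoc.prems(1)[OF ux order.refl] unfolding G'_def by blast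
  have D': "C_mat B (k # u @ [x]) = D ** elem_mat \<epsilon> x M"
    using C_mat_snoc[of \<epsilon> B "k # u" x] \<epsilon> by (simp add: D_def M_def)
  have C': "C_mat ?B1 (u @ [x]) = C ** elem_mat \<epsilon>' x M"
    using C_mat_snoc[of \<epsilon>' ?B1 u x] \<epsilon>' by (simp add: C_def M1)
  have G': "G' = G ** transpose (elem_mat \<epsilon>' x M)"
    using G_mat_snoc[of \<epsilon>' ?B1 u x] \<epsilon>' B1 C_G_duality[OF B1 u] by (simp add: G'_def G_def C_def M1)
  have G'_nth: "G' $ k $ y = (if y = x then (\<Sum>z\<in>UNIV. G $ k $ z * elem_mat \<epsilon>' x M $ x $ z) else G $ k $ y)" for y
  proof (cases "y = x")
    case False
    then have "G' $ k $ y = (\<Sum>z\<in>UNIV. G $ k $ z * (if y = z then 1 else 0))"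
      by (simp add: G' matrix_matrix_mult_def transpose_def elem_nth)
    also have "\<dots> = G $ k $ y"
      by (subst sum_UNIV_single[of y]) auto
    finally show ?thesis
      using False by simp
  qed (simp add: G' matrix_matrix_mult_def transpose_def)
  have Dr: "D $ r $ x = C $ r $ x" if "r \<noteq> k" for r
    using that by (simp add: \<eta>(2) elem_mult_nth)
  show ?case
  proof (cases "\<exists>r. r \<noteq> k \<and> C $ r $ x \<noteq> 0")
    case True
    then obtain r where r: "r \<noteq> k" "C $ r $ x \<noteq> 0"
      by blast
    then have "\<epsilon>' = \<epsilon>"
      using \<epsilon>(1) \<epsilon>(2)[of r] \<epsilon>'(1) \<epsilon>'(2)[of r] Dr[OF r(1)] by auto
    then have "C_mat B (k # u @ [x]) = elem_mat \<eta> k B ** C_mat ?B1 (u @ [x])"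
      by (simp add: D' C' \<eta>(2) matrix_mul_assoc)
    \<comment> \<open>If row \<open>k\<close> of G changed its sign, its entries outside column
      \<open>x\<close> would be 0, and \<open>G C\<^sup>T = 1\<close> would make column
      \<open>x\<close> of \<open>C\<close> a multiple of the \<open>k\<close>-th unit
      vector.\<close>
    moreover have "\<tau> = \<eta>"
    proof (rule ccontr)
      assume "\<tau> \<noteq> \<eta>"
      then have "G $ k $ y = 0" if "y \<noteq> x" for y
        using that \<tau>(1) \<eta>(1) \<tau>(2)[of y] \<eta>(3)[of y] G'_nth[of y] by auto
      then have "G $ k $ x * C $ s $ x = (if k = s then 1 else 0)" for s
        using C_G_row_sum[OF B1 u, of k s] sum_UNIV_single[of x "\<lambda>y. G $ k $ y * C $ s $ y"]
        by (simp add: G_def C_def)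
      from this[of k] this[of r] show False
        using r by auto
    qed
    ultimately show ?thesis
      using \<tau> by (auto simp: G'_def)
  next
    case False
    define \<delta> where "\<delta> = C $ k $ x"
    have C: "C $ r $ x = (if r = k then \<delta> else 0)" for r
      using False by (auto simp: \<delta>_def)
    have \<delta>: "\<delta> \<in> {1, -1}"
    proof -
      have "\<bar>\<delta>\<bar> = 1"
        using C_mat_column_multiple_of_unit[OF B1 u, of k x] False unfolding \<delta>_def C_def by blast
      then show ?thesis
        by auto
    qed
    have \<epsilon>'\<delta>: "\<epsilon>' = \<delta>"
      using \<epsilon>'(1) \<epsilon>'(2)[of k] \<delta> by (auto simp: C)
    have "(\<Sum>z\<in>UNIV. max (\<eta> * B $ k $ z) 0 * C $ z $ x) = 0"
      using B by (subst sum_UNIV_single[of k]) (simp_all add: C)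
    then have "D $ k $ x = - \<delta>"
      unfolding \<eta>(2) elem_mult_nth by (simp add: C)
    then have \<epsilon>\<delta>: "\<epsilon> = - \<delta>"
      using \<epsilon>(1) \<epsilon>(2)[of k] \<delta> by auto
    \<comment> \<open>By \<open>C\<^sup>T G = 1\<close>, row \<open>k\<close> of G is then a
      multiple of a unit vector too, which ties \<eta> to \<delta>.\<close>
    have G_row: "G $ k $ y = (if y = x then \<delta> else 0)" for y
      using C_G_column_sum[OF B1 u, of x y] sum_UNIV_single[of k "\<lambda>r. C $ r $ x * G $ r $ y"] \<delta>
      by (auto simp: C_def[symmetric] G_def[symmetric] C split: if_splits)
    then have "\<eta> = \<delta>"
      using \<eta>(1) \<eta>(3)[of x] \<delta> by auto
    have "transpose C ** ?B1 ** C = M"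
      using transpose_C_B_C[OF B1 u] by (simp add: C_def M1)
    then have "elem_mat (- \<delta>) k ?B1 ** C ** elem_mat (- \<delta>) x M = elem_mat \<delta> k ?B1 ** C ** elem_mat \<delta> x M"
      using B1 M \<delta> C by (intro elem_mult_switch) auto
    \<comment> \<open>Passing from the mutated matrix back to \<open>B\<close> flips the sign of the
      left factors.\<close>
    then have "elem_mat \<delta> k B ** C ** elem_mat (- \<delta>) x M = elem_mat (- \<delta>) k B ** C ** elem_mat \<delta> x M"
      using B by (simp add: elem_mutate)
    then have "C_mat B (k # u @ [x]) = elem_mat (- \<delta>) k B ** C_mat ?B1 (u @ [x])"
      by (simp add: D' C' \<eta>(2) \<epsilon>\<delta> \<epsilon>'\<delta> \<open>\<eta> = \<delta>\<close> matrix_mul_assoc)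
    moreover have "G' $ k $ y = (if y = x then - \<delta> else 0)" for y
      using M sum_UNIV_single[of x "\<lambda>z. G $ k $ z * elem_mat \<epsilon>' x M $ x $ z"]
      by (simp add: G'_nth G_row elem_nth)
    ultimately show ?thesis
      using \<delta> by (intro bexI[of _ "- \<delta>"]) (auto simp: G'_def)
  qed
qed

section \<open>Transposed G-matrices as C-matrices\<close>

lemma G_mat_eqI:
  assumes "skew_cluster_cyclic B" "w \<in> reduced_seqs" "transpose (C_mat B w) ** H = mat 1"
  shows "G_mat B w = H"
  using C_G_duality[OF assms(1,2)] assms(3)
  by (metis matrix_left_right_inverse matrix_mul_assoc matrix_mul_lid matrix_mul_rid)

text \<open>A left factor of G is a right factor of its transpose, that is, a last mutation of the
  reversed sequence. The induction hypothesis for sequences not longer than \<open>u\<close> turns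
  column coherence of C into the row coherence that \<open>C_mat_Cons\<close> needs.\<close>

lemma transpose_G_mat_eq_C_mat:
  assumes "skew_cluster_cyclic B" "w \<in> reduced_seqs"
  shows "transpose (G_mat B w) = C_mat (- B_mat B w) (rev w)"
  using assms
proof (induction "length w" arbitrary: B w rule: less_induct)
  case less
  show ?case
  proof (cases w)
    case Nil
    then show ?thesis
      by (simp add: G_mat_simps(1) C_mat_simps(1))
  next
    case (Cons k u)
    let ?B1 = "mutate k B"
    have B1: "skew_cluster_cyclic ?B1" and u: "u \<in> reduced_seqs"
      using less.prems Cons by (simp_all add: skew_cluster_cyclic_mutate reduced_Cons)
    have IH: "transpose (G_mat ?B1 v) = C_mat (- B_mat ?B1 v) (rev v)" if "v \<in> reduced_seqs" "length v \<le> length u" for v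
      using less.hyps[of v ?B1] that B1 Cons by simp
    have coh: "\<exists>\<tau>\<in>{1, -1}. \<forall>y. 0 \<le> \<tau> * G_mat ?B1 v $ k $ y" if v: "v \<in> reduced_seqs" "length v \<le> length u" for v
    proof -
      have "skew_cluster_cyclic (- B_mat ?B1 v)" "rev v \<in> reduced_seqs"
        using B1 v by (simp_all add: skew_cluster_cyclic_uminus skew_cluster_cyclic_B_mat reduced_rev)
      then obtain \<epsilon> where "\<epsilon> \<in> {1, -1}" "\<And>r. 0 \<le> \<epsilon> * transpose (G_mat ?B1 v) $ r $ k"
        unfolding IH[OF v] using C_mat_sign_coherent by blast
      then show ?thesis
        by (auto simp: transpose_def)
    qed
    obtain \<eta> where \<eta>: "\<eta> \<in> {1, -1}" "C_mat B (k # u) = elem_mat \<eta> k B ** C_mat ?B1 u" "\<And>y. 0 \<le> \<eta> * G_mat ?B1 u $ k $ y"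
      using C_mat_Cons[OF less.prems(1) coh] less.prems(2) Cons by blast
    have "transpose (C_mat B w) ** (transpose (elem_mat \<eta> k B) ** G_mat ?B1 u) =
        transpose (C_mat ?B1 u) ** (transpose (elem_mat \<eta> k B) ** (transpose (elem_mat \<eta> k B) ** G_mat ?B1 u))"
      by (simp add: Cons \<eta>(2) matrix_transpose_mul matrix_mul_assoc)
    also have "\<dots> = mat 1"
      using less.prems(1) C_G_duality[OF B1 u] by (simp add: transpose_elem_mult_cancel)
    finally have "G_mat B w = transpose (elem_mat \<eta> k B) ** G_mat ?B1 u"
      by (rule G_mat_eqI[OF less.prems])
    then have G: "transpose (G_mat B w) = transpose (G_mat ?B1 u) ** elem_mat \<eta> k B"
      by (simp add: matrix_transpose_mul)
    \<comment> \<open>The reversed sequence starts at \<open>M\<close>; the row sign \<eta> of G is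
      the sign of the column at which its last mutation takes place.\<close>
    define M where "M = - B_mat ?B1 u"
    have "B_mat M (rev u) = - ?B1"
      unfolding M_def using B1 by (simp add: B_mat_uminus B_mat_rev skew_B_mat)
    moreover have "0 \<le> \<eta> * C_mat M (rev u) $ r $ k" for r
      using \<eta>(3)[of r] IH[OF u, symmetric] by (simp add: M_def transpose_def)
    ultimately have "C_mat M (rev u @ [k]) = C_mat M (rev u) ** elem_mat \<eta> k (- ?B1)"
      using C_mat_snoc[OF \<eta>(1)] by metis
    moreover have "elem_mat \<eta> k (- ?B1) = elem_mat \<eta> k B"
      using less.prems(1) by (simp add: elem_uminus elem_mutate)
    moreover have "M = - B_mat B w"
      by (simp add: M_def Cons B_mat_Cons)
    ultimately show ?thesis
      using G IH[OF u] by (simp add: M_def Cons)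
  qed
qed

lemma G_mat_row_sign_coherent:
  assumes B: "skew_cluster_cyclic B" and w: "w \<in> reduced_seqs"
  shows "\<exists>\<tau>\<in>{1, -1}. \<forall>y. 0 \<le> \<tau> * G_mat B w $ k $ y"
proof -
  have "skew_cluster_cyclic (- B_mat B w)" "rev w \<in> reduced_seqs"
    using B w by (simp_all add: skew_cluster_cyclic_uminus skew_cluster_cyclic_B_mat reduced_rev)
  then obtain \<epsilon> where "\<epsilon> \<in> {1, -1}" "\<And>r. 0 \<le> \<epsilon> * transpose (G_mat B w) $ r $ k"
    unfolding transpose_G_mat_eq_C_mat[OF B w] using C_mat_sign_coherent by blast
  then show ?thesis
    by (auto simp: transpose_def)
qed

text \<open>The last two clauses read \<eta> off the G-matrix at either seed; the signs are opposite
  because the left factor of G negates row \<open>k\<close>.\<close>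

lemma change_initial_seed:
  assumes B: "skew_cluster_cyclic B" and red: "k # u \<in> reduced_seqs"
  obtains \<eta> where "\<eta> \<in> {1, -1}" "C_mat B (k # u) = elem_mat \<eta> k B ** C_mat (mutate k B) u"
    "\<And>y. 0 \<le> \<eta> * G_mat (mutate k B) u $ k $ y" "\<And>y. 0 \<le> - \<eta> * G_mat B (k # u) $ k $ y"
proof -
  let ?B1 = "mutate k B"
  have B1: "skew_cluster_cyclic ?B1" and u: "u \<in> reduced_seqs"
    using B red by (simp_all add: skew_cluster_cyclic_mutate reduced_Cons)
  obtain \<eta> where \<eta>: "\<eta> \<in> {1, -1}" "C_mat B (k # u) = elem_mat \<eta> k B ** C_mat ?B1 u" "\<And>y. 0 \<le> \<eta> * G_mat ?B1 u $ k $ y"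
    using C_mat_Cons[OF B G_mat_row_sign_coherent[OF B1] red] by blast
  have "transpose (C_mat B (k # u)) ** (transpose (elem_mat \<eta> k B) ** G_mat ?B1 u) = mat 1"
    using B C_G_duality[OF B1 u]
    by (simp add: \<eta>(2) matrix_transpose_mul matrix_mul_assoc transpose_elem_mult_cancel)
  then have "G_mat B (k # u) = transpose (elem_mat \<eta> k B) ** G_mat ?B1 u"
    by (rule G_mat_eqI[OF B red])
  then have "G_mat B (k # u) $ k $ y = - G_mat ?B1 u $ k $ y" for y
    using B by (simp add: transpose_elem_mult_nth)
  then show thesis
    using that \<eta> by simp
qed

section \<open>Injectivity\<close>

definition column_equiv :: "mat3 \<Rightarrow> mat3 \<Rightarrow> bool" where
  "column_equiv M N \<longleftrightarrow> (\<exists>\<sigma> s. bij \<sigma> \<and> (\<forall>y. 0 < s y) \<and> (\<forall>x y. M $ x $ y = s y * N $ x $ \<sigma> y))"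

lemma column_equiv_mult_left:
  assumes "column_equiv M N"
  shows "column_equiv (A ** M) (A ** N)"
proof -
  obtain \<sigma> s where \<sigma>: "bij \<sigma>" "\<And>y. 0 < s y" "\<And>x y. M $ x $ y = s y * N $ x $ \<sigma> y"
    using assms unfolding column_equiv_def by blast
  have "(A ** M) $ x $ y = s y * (A ** N) $ x $ \<sigma> y" for x y
    by (simp add: matrix_matrix_mult_def \<sigma>(3) sum_distrib_left algebra_simps)
  then show ?thesis
    unfolding column_equiv_def using \<sigma>(1,2) by blast
qed

text \<open>The inverse transpose has the same permutation and reciprocal scalars; so the relation
  passes between C and G.\<close>

lemma column_equiv_inverse_transpose:
  assumes "column_equiv M N" "transpose M ** M' = mat 1" "transpose N ** N' = mat 1"
  shows "column_equiv M' N'"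
proof -
  obtain \<sigma> s where \<sigma>: "bij \<sigma>" "\<And>y. 0 < s y" "\<And>x y. M $ x $ y = s y * N $ x $ \<sigma> y"
    using assms(1) unfolding column_equiv_def by blast
  define H :: mat3 where "H = (\<chi> x y. inverse (s y) * N' $ x $ \<sigma> y)"
  have "(transpose M ** H) $ x $ y = (mat 1 :: mat3) $ x $ y" for x y
  proof -
    have "(transpose M ** H) $ x $ y = s x * inverse (s y) * (transpose N ** N') $ \<sigma> x $ \<sigma> y"
      by (simp add: matrix_matrix_mult_def transpose_def \<sigma>(3) H_def sum_distrib_left algebra_simps)
    then show ?thesis
      using \<sigma>(1) \<sigma>(2)[of y] by (auto simp: assms(3) mat_def bij_def inj_eq)
  qed
  then have "transpose M ** H = mat 1"
    by (simp add: vec_eq_iff)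
  then have "M' = H"
    using assms(2) by (metis matrix_left_right_inverse matrix_mul_assoc matrix_mul_lid matrix_mul_rid)
  then show ?thesis
    unfolding column_equiv_def using \<sigma>(1,2)
    by (intro exI[of _ \<sigma>] exI[of _ "\<lambda>y. inverse (s y)"]) (simp add: H_def)
qed

text \<open>A row with both signs would vanish, but G is invertible.\<close>

lemma G_mat_row_sign_unique:
  assumes B: "skew_cluster_cyclic B" and w: "w \<in> reduced_seqs"
    and eq: "column_equiv (G_mat B w) (G_mat B u)"
    and \<tau>: "\<tau> \<in> {1, -1}" "\<And>y. 0 \<le> \<tau> * G_mat B w $ k $ y"
    and \<tau>': "\<tau>' \<in> {1, -1}" "\<And>y. 0 \<le> \<tau>' * G_mat B u $ k $ y"
  shows "\<tau> = \<tau>'"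
proof (rule ccontr)
  assume "\<tau> \<noteq> \<tau>'"
  then have \<tau>': "\<And>y. 0 \<le> - \<tau> * G_mat B u $ k $ y"
    using \<tau>(1) \<tau>' by auto
  obtain \<sigma> s where \<sigma>: "\<And>y. 0 < s y" "\<And>x y. G_mat B w $ x $ y = s y * G_mat B u $ x $ \<sigma> y"
    using eq unfolding column_equiv_def by blast
  have "G_mat B w $ k $ y = 0" for y
    using \<tau>(1) \<tau>(2)[of y] \<tau>'[of "\<sigma> y"] \<sigma>(1)[of y]
    by (auto simp: \<sigma>(2) zero_le_mult_iff mult_le_0_iff)
  then show False
    using C_G_row_sum[OF B w, of k k] by simp
qed

text \<open>Peel off the first letter \<open>k\<close> of \<open>w\<close> by moving the initial
  seed along \<open>k\<close>. The G-matrices are equivalent too, so their \<open>k\<close>-th rows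
  have the same sign and the change of seed acts on both C-matrices by the same left factor.\<close>

lemma C_mat_column_equiv_imp_eq:
  assumes "skew_cluster_cyclic B" "w \<in> reduced_seqs" "u \<in> reduced_seqs"
    and "column_equiv (C_mat B w) (C_mat B u)"
  shows "w = u"
  using assms
proof (induction w arbitrary: B u)
  case Nil
  show ?case
  proof (rule ccontr)
    assume "[] \<noteq> u"
    then obtain x where x: "\<And>r. C_mat B u $ r $ x \<le> 0"
      using C_mat_nonpos_column Nil.prems by metis
    obtain \<sigma> s where \<sigma>: "bij \<sigma>" "\<And>y. 0 < s y" "\<And>x y. C_mat B [] $ x $ y = s y * C_mat B u $ x $ \<sigma> y"
      using Nil.prems(4) unfolding column_equiv_def by blast
    obtain y where y: "x = \<sigma> y"
      using \<sigma>(1) by (metis bij_pointE)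
    have "1 = s y * C_mat B u $ y $ x"
      using \<sigma>(3)[of y y] by (simp add: y C_mat_simps mat_def)
    then show False
      using mult_nonneg_nonpos[of "s y" "C_mat B u $ y $ x"] \<sigma>(2)[of y] x[of y] by simp
  qed
next
  case (Cons k w)
  let ?B1 = "mutate k B"
  have B1: "skew_cluster_cyclic ?B1" and w: "w \<in> reduced_seqs"
    using Cons.prems by (simp_all add: skew_cluster_cyclic_mutate reduced_Cons)
  have skew: "skew B"
    using Cons.prems by simp
  have eqG: "column_equiv (G_mat B (k # w)) (G_mat B u)"
    using column_equiv_inverse_transpose[OF Cons.prems(4)] C_G_duality Cons.prems by blast
  obtain \<eta> where \<eta>: "\<eta> \<in> {1, -1}" "C_mat B (k # w) = elem_mat \<eta> k B ** C_mat ?B1 w"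
    "\<And>y. 0 \<le> - \<eta> * G_mat B (k # w) $ k $ y"
    using change_initial_seed[OF Cons.prems(1,2)] by metis
  have \<eta>_neg: "- \<eta> \<in> {1, -1}"
    using \<eta>(1) by auto
  have eqC: "column_equiv (C_mat ?B1 w) (elem_mat \<eta> k B ** C_mat B u)"
    using column_equiv_mult_left[OF Cons.prems(4), of "elem_mat \<eta> k B"] \<eta>(2) by (simp add: elem_mult_cancel skew)
  show ?case
  proof (cases "\<exists>v. u = k # v")
    case True
    then obtain v where v: "u = k # v"
      by blast
    obtain \<theta> where \<theta>: "\<theta> \<in> {1, -1}" "C_mat B (k # v) = elem_mat \<theta> k B ** C_mat ?B1 v"
      "\<And>y. 0 \<le> - \<theta> * G_mat B (k # v) $ k $ y"
      using change_initial_seed[OF Cons.prems(1), of k v] Cons.prems(3) v by metis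
    have "- \<eta> = - \<theta>"
      using G_mat_row_sign_unique[OF Cons.prems(1,2) eqG \<eta>_neg \<eta>(3), of "- \<theta>"] \<theta> v by auto
    then have "column_equiv (C_mat ?B1 w) (C_mat ?B1 v)"
      using eqC \<theta>(2) by (simp add: v elem_mult_cancel skew)
    then show ?thesis
      using Cons.IH[OF B1 w] Cons.prems(3) v by (simp add: reduced_Cons)
  next
    case False
    \<comment> \<open>Here moving the seed prefixes \<open>k\<close> to \<open>u\<close>. The
      induction then gives \<open>w = k # u\<close>, impossible as \<open>k # w\<close> is
      reduced.\<close>
    then have ku: "k # u \<in> reduced_seqs"
      using Cons.prems(3) by (cases u) (auto simp: reduced_Cons)
    obtain \<theta> where \<theta>: "\<theta> \<in> {1, -1}" "C_mat ?B1 (k # u) = elem_mat \<theta> k ?B1 ** C_mat B u"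
      "\<And>y. 0 \<le> \<theta> * G_mat B u $ k $ y"
      using change_initial_seed[OF B1 ku] by (metis mutate_involution skew)
    have "- \<eta> = \<theta>"
      using G_mat_row_sign_unique[OF Cons.prems(1,2) eqG \<eta>_neg \<eta>(3) \<theta>(1,3)] .
    then have "elem_mat \<theta> k ?B1 = elem_mat \<eta> k B"
      using elem_mutate[OF skew, of \<theta> k] by auto
    then have "C_mat ?B1 (k # u) = elem_mat \<eta> k B ** C_mat B u"
      using \<theta>(2) by simp
    then have "w = k # u"
      using Cons.IH[OF B1 w ku] eqC by simp
    then show ?thesis
      using Cons.prems(2) by (simp add: reduced_Cons)
  qed
qed

lemma G_mat_column_equiv_imp_eq:
  assumes "skew_cluster_cyclic B" "w \<in> reduced_seqs" "u \<in> reduced_seqs"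
    and "column_equiv (G_mat B w) (G_mat B u)"
  shows "w = u"
proof -
  have "transpose (G_mat B v) ** C_mat B v = mat 1" if "v \<in> reduced_seqs" for v
    using C_G_duality[OF assms(1) that] by (metis matrix_transpose_mul transpose_mat transpose_transpose)
  then show ?thesis
    using C_mat_column_equiv_imp_eq[OF assms(1-3)] column_equiv_inverse_transpose[OF assms(4)] assms(2,3) by blast
qed

section \<open>Reduction to skew-symmetric matrices\<close>

definition conjugate :: "(3 \<Rightarrow> real) \<Rightarrow> mat3 \<Rightarrow> mat3" where
  "conjugate s M = (\<chi> i j. s i * M $ i $ j / s j)"

context
  fixes s :: "3 \<Rightarrow> real"
  assumes s_pos: "0 < s i"
begin

lemma conjugate_mult: "conjugate s (M ** N) = conjugate s M ** conjugate s N"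
  using less_imp_neq[OF s_pos]
  by (simp add: vec_eq_iff conjugate_def matrix_matrix_mult_def sum_distrib_left sum_divide_distrib mult.assoc)

lemma conjugate_plus: "conjugate s (M + N) = conjugate s M + conjugate s N"
  by (simp add: vec_eq_iff conjugate_def algebra_simps add_divide_distrib)

lemma conjugate_uminus: "conjugate s (- M) = - conjugate s M"
  by (simp add: vec_eq_iff conjugate_def)

lemma conjugate_minus: "conjugate s (M - N) = conjugate s M - conjugate s N"
  using conjugate_plus[of M "- N"] by (simp add: conjugate_uminus)

lemma conjugate_mat_1: "conjugate s (mat 1) = mat 1"
  using less_imp_neq[OF s_pos] by (auto simp: vec_eq_iff conjugate_def mat_def)

lemma conjugate_J: "conjugate s (J k) = J k"
  using less_imp_neq[OF s_pos] by (auto simp: vec_eq_iff conjugate_def J_def)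

lemma conjugate_only_row: "conjugate s (only_row k M) = only_row k (conjugate s M)"
  by (simp add: vec_eq_iff conjugate_def only_row_def)

lemma conjugate_only_col: "conjugate s (only_col k M) = only_col k (conjugate s M)"
  by (simp add: vec_eq_iff conjugate_def only_col_def)

text \<open>Since \<open>s i / s j\<close> is positive, rescaling commutes with the positive part;
  this makes the recurrences for B, C and G compatible with conjugation.\<close>

lemma conjugate_pos_part: "conjugate s (pos_part M) = pos_part (conjugate s M)"
proof -
  have "s i * max t 0 / s j = max (s i * t / s j) 0" for i j t
    using s_pos[of i] s_pos[of j] by (auto simp: max_def field_simps mult_le_0_iff)
  then show ?thesis
    by (simp add: vec_eq_iff conjugate_def pos_part_def map_matrix_def)
qed

lemmas conjugate_simps = conjugate_mult conjugate_plus conjugate_uminus conjugate_minus conjugate_mat_1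
  conjugate_J conjugate_only_row conjugate_only_col conjugate_pos_part

lemma B_mat_conjugate: "B_mat (conjugate s B) w = conjugate s (B_mat B w)"
  by (induction w rule: rev_induct) (simp_all add: B_mat_simps mutate_def conjugate_simps)

lemma C_mat_conjugate: "C_mat (conjugate s B) w = conjugate s (C_mat B w)"
  by (induction w rule: rev_induct) (simp_all add: C_mat_simps B_mat_conjugate conjugate_simps)

lemma G_mat_conjugate: "G_mat (conjugate s B) w = conjugate s (G_mat B w)"
  by (induction w rule: rev_induct) (simp_all add: G_mat_simps B_mat_conjugate C_mat_conjugate conjugate_simps)

lemma cluster_cyclic_conjugate: "cluster_cyclic (conjugate s B) \<longleftrightarrow> cluster_cyclic B"
proof -
  have "map_matrix sgn (conjugate s M) = map_matrix sgn M" for M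
    using s_pos by (simp add: vec_eq_iff conjugate_def map_matrix_def sgn_mult sgn_divide)
  then show ?thesis
    by (simp add: cluster_cyclic_def B_mat_conjugate cyclic_def)
qed

lemma same_unlabeled_imp_column_equiv_conjugate:
  assumes "same_unlabeled M N"
  shows "column_equiv (conjugate s N) (conjugate s M)"
proof -
  obtain \<sigma> where \<sigma>: "bij \<sigma>" "N = (\<chi> i j. M $ i $ \<sigma> j)"
    using assms unfolding same_unlabeled_def by blast
  have "conjugate s N $ x $ y = s (\<sigma> y) / s y * conjugate s M $ x $ \<sigma> y" for x y
    using less_imp_neq[OF s_pos, of "\<sigma> y"] by (simp add: \<sigma>(2) conjugate_def)
  moreover have "0 < s (\<sigma> y) / s y" for y
    using s_pos by simp
  ultimately show ?thesis
    unfolding column_equiv_def using \<sigma>(1) by (intro exI[of _ \<sigma>] exI[of _ "\<lambda>y. s (\<sigma> y) / s y"]) simp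
qed

end

text \<open>Conjugating by the square root of the symmetrizer makes \<open>B\<close> skew-symmetric, at the cost of
  rescaling permuted columns.\<close>

lemma skew_symmetrizable_conjugate:
  assumes "skew_symmetrizable B"
  obtains s where "\<And>i. 0 < s i" "skew (conjugate s B)"
proof -
  obtain D :: mat3 where D: "\<And>i j. i \<noteq> j \<Longrightarrow> D $ i $ j = 0" "\<And>i. D $ i $ i > 0"
    and skew: "transpose (D ** B) = - (D ** B)"
    using assms unfolding skew_symmetrizable_def by blast
  define s where "s i = sqrt (D $ i $ i)" for i
  have s: "0 < s i" "D $ i $ i = s i * s i" for i
    using D(2)[of i] by (simp_all add: s_def)
  have DB: "(D ** B) $ i $ j = s i * s i * B $ i $ j" for i j
    unfolding matrix_matrix_mult_def by (simp, subst sum_UNIV_single[of i]) (simp_all add: D(1) s(2))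
  have "conjugate s B $ x $ y = - conjugate s B $ y $ x" for x y
  proof -
    have "transpose (D ** B) $ x $ y = - (D ** B) $ x $ y"
      by (simp add: skew)
    then have "s y * s y * B $ y $ x = - (s x * s x * B $ x $ y)"
      unfolding transpose_def by (simp add: DB)
    then show ?thesis
      using s(1)[of x] s(1)[of y] by (simp add: conjugate_def field_simps)
  qed
  then show thesis
    using that s(1) skewI by blast
qed

lemma same_unlabeled_imp_eq:
  assumes "skew_symmetrizable B" "cluster_cyclic B" "w \<in> reduced_seqs" "u \<in> reduced_seqs"
  shows "same_unlabeled (C_mat B w) (C_mat B u) \<Longrightarrow> w = u"
    and "same_unlabeled (G_mat B w) (G_mat B u) \<Longrightarrow> w = u"
proof -
  obtain s where s: "\<And>i. 0 < s i" "skew (conjugate s B)"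
    using skew_symmetrizable_conjugate[OF assms(1)] by blast
  then have B: "skew_cluster_cyclic (conjugate s B)"
    using assms(2) by (simp add: skew_cluster_cyclic_def cluster_cyclic_conjugate)
  show "same_unlabeled (C_mat B w) (C_mat B u) \<Longrightarrow> w = u"
    using C_mat_column_equiv_imp_eq[OF B assms(4,3)] same_unlabeled_imp_column_equiv_conjugate[of s, OF s(1)]
    by (simp add: C_mat_conjugate[of s, OF s(1)])
  show "same_unlabeled (G_mat B w) (G_mat B u) \<Longrightarrow> w = u"
    using G_mat_column_equiv_imp_eq[OF B assms(4,3)] same_unlabeled_imp_column_equiv_conjugate[of s, OF s(1)]
    by (simp add: G_mat_conjugate[of s, OF s(1)])
qed

section \<open>The exchange graphs\<close>

lemma step_append: "w = [] \<or> k \<noteq> last w \<Longrightarrow> step w k = w @ [k]"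
  by (simp add: step_def)

lemma step_cases:
  obtains "w = [] \<or> k \<noteq> last w" "step w k = w @ [k]" | "w \<noteq> []" "k = last w" "step w k = butlast w"
  by (auto simp: step_def)

lemma step_reduced: "w \<in> reduced_seqs \<Longrightarrow> step w k \<in> reduced_seqs"
  by (cases w k rule: step_cases) (auto simp: reduced_snoc step_def, metis append_butlast_last_id reduced_snoc)

lemma step_step:
  assumes "w \<in> reduced_seqs"
  shows "step (step w k) k = w"
proof (cases w k rule: step_cases)
  case 1
  then show ?thesis
    by (simp add: step_def)
next
  case 2
  then have w: "w = butlast w @ [k]"
    by simp
  then have "butlast w = [] \<or> k \<noteq> last (butlast w)"
    using assms reduced_snoc by metis
  then show ?thesis
    using 2 w by (simp add: step_append)
qed

lemma length_step: "length (step w k) = Suc (length w) \<or> length w = Suc (length (step w k))"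
  by (cases w k rule: step_cases) auto

lemma inj_step: "inj (step w)"
proof (rule injI)
  fix k l
  assume eq: "step w k = step w l"
  have "w @ [m] \<noteq> butlast w" for m
  proof
    assume "w @ [m] = butlast w"
    then have "length (w @ [m]) = length (butlast w)"
      by simp
    then show False
      unfolding length_append length_butlast by simp
  qed
  then show "k = l"
    using eq by (cases w k rule: step_cases; cases w l rule: step_cases) (metis butlast_snoc last_snoc)+
qed

lemma step_shorter: "length (step w k) \<le> length w \<Longrightarrow> step w k = butlast w"
  by (cases w k rule: step_cases) auto

lemma step_longer:
  assumes "length w \<le> length (step w k)"
  shows "w = butlast (step w k)"
proof (cases w k rule: step_cases)
  case 2
  then have "length (step w k) < length w"
    by simp
  then show ?thesis
    using assms by simp
qed simp

text \<open>A copy of the sequence tree, namely its quotient by equality; once distinct sequences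
  are inequivalent, both exchange graphs are equal to it.\<close>

definition seq_singleton_graph :: "3 list set pair_pre_digraph" where
  "seq_singleton_graph = \<lparr> pverts = (\<lambda>w. {w}) ` reduced_seqs,
     parcs = {({w}, {step w k}) | w k. w \<in> reduced_seqs} \<rparr>"

lemma quotient_graph_seq_graph_inj:
  assumes "\<And>w u. w \<in> reduced_seqs \<Longrightarrow> u \<in> reduced_seqs \<Longrightarrow> same_unlabeled (M w) (M u) \<Longrightarrow> w = u"
  shows "quotient_graph seq_graph (unlabeled_rel M) = seq_singleton_graph"
proof -
  have "unlabeled_rel M = Id_on reduced_seqs"
    using assms by (auto simp: unlabeled_rel_def same_unlabeled_refl)
  moreover have "reduced_seqs // Id_on reduced_seqs = (\<lambda>w. {w}) ` reduced_seqs"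
    by (auto simp: quotient_def)
  ultimately show ?thesis
    by (auto simp: quotient_graph_def seq_graph_def seq_singleton_graph_def step_reduced)
qed

section \<open>The quotient graph is a 3-regular tree\<close>

lemma parcs_seq_singleton_graph_sym:
  assumes "(X, Y) \<in> parcs seq_singleton_graph"
  shows "(Y, X) \<in> parcs seq_singleton_graph"
proof -
  obtain w k where w: "w \<in> reduced_seqs" "X = {w}" "Y = {step w k}"
    using assms by (auto simp: seq_singleton_graph_def)
  then have "(Y, X) = ({step w k}, {step (step w k) k})"
    by (simp add: step_step)
  then show ?thesis
    using step_reduced[OF w(1), of k] unfolding seq_singleton_graph_def by auto
qed

lemma pair_bidirected_digraph_seq_singleton_graph: "pair_bidirected_digraph seq_singleton_graph"
proof
  fix e
  assume e: "e \<in> parcs seq_singleton_graph"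
  then show "fst e \<in> pverts seq_singleton_graph" "snd e \<in> pverts seq_singleton_graph"
    by (auto simp: seq_singleton_graph_def step_reduced)
  obtain w k where "e = ({w}, {step w k})"
    using e by (auto simp: seq_singleton_graph_def)
  then show "fst e \<noteq> snd e"
    using length_step[of w k] by auto
next
  show "symmetric (with_proj seq_singleton_graph)"
    using parcs_seq_singleton_graph_sym by (simp add: symmetric_def sym_def)
qed

lemma connected_seq_singleton_graph: "Digraph_Component.connected (with_proj seq_singleton_graph)"
proof -
  interpret pair_bidirected_digraph seq_singleton_graph
    by (rule pair_bidirected_digraph_seq_singleton_graph)
  have root: "reachable (with_proj seq_singleton_graph) {[]} {w}" if "w \<in> reduced_seqs" for w
    using that
  proof (induction w rule: rev_induct)
    case Nil
    then show ?case
      by (intro reachable_refl) (simp add: seq_singleton_graph_def)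
  next
    case (snoc k w)
    then have w: "w \<in> reduced_seqs" and step: "step w k = w @ [k]"
      by (simp_all add: reduced_snoc step_append)
    have "({w}, {step w k}) \<in> parcs seq_singleton_graph"
      using w by (auto simp: seq_singleton_graph_def)
    then have "({w}, {w @ [k]}) \<in> parcs seq_singleton_graph"
      by (simp only: step)
    then show ?case
      using snoc.IH[OF w] reachable_adj_trans by blast
  qed
  \<comment> \<open>The arcs are symmetric already, so connectedness amounts to reachability in the
    graph itself.\<close>
  have "mk_symmetric (with_proj seq_singleton_graph) = seq_singleton_graph"
    using parcs_seq_singleton_graph_sym unfolding mk_symmetric_def
    by (intro pair_pre_digraph.equality) auto
  moreover have "reachable (with_proj seq_singleton_graph) X Y" if "X \<in> pverts seq_singleton_graph" "Y \<in> pverts seq_singleton_graph" for X Y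
  proof -
    obtain w u where wu: "w \<in> reduced_seqs" "X = {w}" "u \<in> reduced_seqs" "Y = {u}"
      using \<open>X \<in> _\<close> \<open>Y \<in> _\<close> by (auto simp: seq_singleton_graph_def)
    have "reachable (with_proj seq_singleton_graph) {w} {[]}"
      using symmetric_reachable[OF pair_sym_arcs root[OF wu(1)]] .
    then show ?thesis
      using root[OF wu(3)] reachable_trans wu by blast
  qed
  moreover have "pverts seq_singleton_graph \<noteq> {}"
    using reduced_Nil by (auto simp: seq_singleton_graph_def)
  ultimately show ?thesis
    by (simp add: Digraph_Component.connected_def strongly_connected_def)
qed

lemma pcas_nth:
  assumes "pcas u p v" "p \<noteq> []"
  shows "fst (p ! 0) = u" "snd (last p) = v" "Suc i < length p \<Longrightarrow> snd (p ! i) = fst (p ! Suc i)"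
proof -
  have "p \<noteq> [] \<longrightarrow> fst (p ! 0) = u \<and> snd (last p) = v \<and> (\<forall>i. Suc i < length p \<longrightarrow> snd (p ! i) = fst (p ! Suc i))"
    using assms(1)
  proof (induction u p v rule: pcas.induct)
    case (2 u e es v)
    show ?case
    proof (cases "es = []")
      case False
      then have IH: "fst (es ! 0) = snd e" "snd (last es) = v" "\<And>i. Suc i < length es \<Longrightarrow> snd (es ! i) = fst (es ! Suc i)"
        using 2 by auto
      have "snd ((e # es) ! i) = fst ((e # es) ! Suc i)" if "Suc i < length (e # es)" for i
        using IH that by (cases i) auto
      then show ?thesis
        using 2 False IH by auto
    qed (use 2 in auto)
  qed simp
  then show "fst (p ! 0) = u" "snd (last p) = v" "Suc i < length p \<Longrightarrow> snd (p ! i) = fst (p ! Suc i)"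
    using assms(2) by blast+
qed

text \<open>Both neighbours of a longest sequence on the cycle are no longer than it, hence both
  arise from it by deleting the last letter; on a cycle of length at least 3 they would be
  distinct.\<close>

lemma no_cycle_seq_singleton_graph:
  assumes cyc: "pre_digraph.cycle (with_proj seq_singleton_graph) p" and len: "length p \<ge> 3"
  shows False
proof -
  interpret pair_pre_digraph seq_singleton_graph .
  let ?n = "length p"
  obtain u where u: "awalk u p u" "distinct (tl (pawalk_verts u p))" "p \<noteq> []"
    using cyc by (auto simp: cycle_def)
  have cas: "pcas u p u" and arcs: "set p \<subseteq> parcs seq_singleton_graph"
    using u(1) by (auto simp: awalk_def)
  have "pawalk_verts u p = fst (hd p) # map snd p"
    using awalk_verts_conv'[of u p u] cas u(3) by simp
  then have dist: "distinct (map snd p)"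
    using u(2) by simp
  have succ: "snd (p ! i) = fst (p ! (Suc i mod ?n))" if "i < ?n" for i
  proof (cases "Suc i = ?n")
    case True
    then have "p ! i = last p"
      using u(3) by (metis diff_Suc_1 last_conv_nth)
    then show ?thesis
      using pcas_nth(1,2)[OF cas u(3)] True by simp
  qed (use that pcas_nth(3)[OF cas u(3), of i] in simp)
  define L where "L i = length (the_elem (snd (p ! i)))" for i
  obtain j where j: "j < ?n" "\<And>i. i < ?n \<Longrightarrow> L i \<le> L j"
  proof -
    have "Max (L ` {..<?n}) \<in> L ` {..<?n}"
      using u(3) by (intro Max_in) auto
    then obtain j where "j < ?n" "L j = Max (L ` {..<?n})"
      by auto
    then show thesis
      using that[of j] by simp
  qed
  \<comment> \<open>Arcs \<open>i\<close>, \<open>j\<close> and \<open>k\<close> are consecutive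
    modulo \<open>?n\<close>; the heads of \<open>i\<close> and \<open>k\<close> are the two
    neighbours of the longest sequence, the head of \<open>j\<close>.\<close>
  define i where "i = (if j = 0 then ?n - 1 else j - 1)"
  have i: "i < ?n" "Suc i mod ?n = j"
    using j(1) u(3) by (auto simp: i_def)
  define k where "k = Suc j mod ?n"
  have k: "k < ?n" "k \<noteq> i"
    using j(1) len by (auto simp: k_def i_def mod_Suc)
  obtain x l where x: "p ! j = ({x}, {step x l})"
    using nth_mem[OF j(1)] arcs by (auto simp: seq_singleton_graph_def)
  obtain y m where y: "p ! k = ({y}, {step y m})"
    using nth_mem[OF k(1)] arcs by (auto simp: seq_singleton_graph_def)
  have "y = step x l" "snd (p ! i) = {x}"
    using succ[OF j(1)] succ[OF i(1)] i(2) x y by (simp_all add: k_def)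
  moreover have "x = butlast (step x l)"
    using j(2)[OF i(1)] x \<open>snd (p ! i) = {x}\<close> by (intro step_longer) (simp add: L_def)
  moreover have "step y m = butlast y"
    using j(2)[OF k(1)] x y \<open>y = step x l\<close> by (intro step_shorter) (simp add: L_def)
  ultimately have "map snd p ! i = map snd p ! k"
    using i(1) k(1) y by simp
  then show False
    using nth_eq_iff_index_eq[OF dist, of i k] i(1) k by simp
qed

lemma undirected_tree_seq_singleton_graph: "undirected_tree seq_singleton_graph"
  unfolding undirected_tree_def
  using pair_bidirected_digraph_seq_singleton_graph connected_seq_singleton_graph no_cycle_seq_singleton_graph by blast

lemma regular_seq_singleton_graph: "regular 3 seq_singleton_graph"
proof -
  have "out_arcs (with_proj seq_singleton_graph) {w} = (\<lambda>k. ({w}, {step w k})) ` UNIV" if "w \<in> reduced_seqs" for w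
    using that by (auto simp: out_arcs_def seq_singleton_graph_def)
  moreover have "inj (\<lambda>k. ({w}, {step w k}))" for w
    using inj_step[of w] by (auto simp: inj_on_def)
  ultimately show ?thesis
    by (auto simp: regular_def out_degree_def seq_singleton_graph_def card_image)
qed

theorem theorem5p2:
  fixes B :: "real^3^3"
  assumes "skew_symmetrizable B"
    and "cluster_cyclic B"
  shows "(undirected_tree (EG_C B) \<and> regular 3 (EG_C B)) \<and>
         (undirected_tree (EG_G B) \<and> regular 3 (EG_G B))"
proof -
  have "EG_C B = seq_singleton_graph" "EG_G B = seq_singleton_graph"
    unfolding EG_C_def EG_G_def
    using same_unlabeled_imp_eq[OF assms] by (intro quotient_graph_seq_graph_inj; blast)+
  then show ?thesis
    using undirected_tree_seq_singleton_graph regular_seq_singleton_graph by simp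
qed

end
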